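(* Let $V:\mathbb{R}\to\mathbb{R}\cup\{\infty\}$ be a convex function and let $q:\mathbb{R}\to\mathbb{R}$ be a bounded function such that $e^{-V(x)}\,dx$ and $e^{-V(x)-q(x)}\,dx$ both belong to $\mathcal{P}(\mathbb{R})$. Then the optimal transport $T$ that takes $e^{-V(x)}\,dx$ to $e^{-V(x)-q(x)}\,dx$ is Lipschitz and satisfies $$\|\log T'\|_{L^\infty(\mathbb{R})}\le\|q^+\|_{L^\infty(\mathbb{R})}+\|q^-\|_{L^\infty(\mathbb{R})}.$$
   Context: $\mathcal{P}(\mathbb{R})$ is the set of Borel probability measures on $\mathbb{R}$; $e^{-\infty}=0$; $q$ is understood to be measurable; $q^+=\max\{q,0\}$ and $q^-=\max\{-q,0\}$. For $\mu,\nu\in\mathcal{P}(\mathbb{R})$ with finite second moments and $\mu$ absolutely continuous, the optimal transport taking $\mu$ to $\nu$ is the $\mu$-a.e. unique minimizer of $\int|x-T(x)|^2\,d\mu(x)$ among Borel maps $T$ with $T_\#\mu=\nu$; equivalently, the $\mu$-a.e. unique nondecreasing map with $T_\#\mu=\nu$. Since $T$ is only unique up to sets of $e^{-V(x)}\,dx$-measure zero, the conclusion is understood as: there is a representative $T:\mathbb{R}\to\mathbb{R}$ of the optimal transport that is Lipschitz and for which the estimate on $\log T'$ holds almost everywhere in $\mathbb{R}$. *)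

theory Defs
  imports "HOL-Probability.Probability"
begin

definition convex_extended :: "(real \<Rightarrow> ereal) \<Rightarrow> bool" where
  "convex_extended V \<longleftrightarrow>
     (\<forall>x. V x \<noteq> -\<infinity>) \<and>
     (\<forall>x y. \<forall>u\<ge>0. \<forall>v\<ge>0. u + v = 1 \<longrightarrow>
        V (u * x + v * y) \<le> ereal u * V x + ereal v * V y)"

text \<open>The convention is that the exponential of minus infinity is 0. The argument
  minus infinity gets a junk value; it does not occur for functions
  satisfying \<open>convex_extended\<close>.\<close>

definition exp_neg :: "ereal \<Rightarrow> real" where
  "exp_neg v = (if v = \<infinity> then 0 else exp (- real_of_ereal v))"

text \<open>The Borel measure \<open>f(x) dx\<close> of a nonnegative Lebesgue measurable density. Going through
  \<open>lebesgue\<close> rather than \<open>lborel\<close> matters only for densities that are not Borel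
  measurable; the pushforward under the identity restricts the measure to Borel sets.\<close>

definition density_measure :: "(real \<Rightarrow> real) \<Rightarrow> real measure" where
  "density_measure f = distr (density lebesgue (\<lambda>x. ennreal (f x))) borel (\<lambda>x. x)"

definition is_transport_map :: "real measure \<Rightarrow> real measure \<Rightarrow> (real \<Rightarrow> real) \<Rightarrow> bool" where
  "is_transport_map \<mu> \<nu> T \<longleftrightarrow> T \<in> borel_measurable borel \<and> distr \<mu> borel T = \<nu>"

definition transport_cost :: "real measure \<Rightarrow> (real \<Rightarrow> real) \<Rightarrow> ennreal" where
  "transport_cost \<mu> T = (\<integral>\<^sup>+ x. ennreal (\<bar>x - T x\<bar>\<^sup>2) \<partial>\<mu>)"

definition is_minimizing_transport :: "real measure \<Rightarrow> real measure \<Rightarrow> (real \<Rightarrow> real) \<Rightarrow> bool" where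
  "is_minimizing_transport \<mu> \<nu> T \<longleftrightarrow>
     is_transport_map \<mu> \<nu> T \<and>
     (\<forall>S. is_transport_map \<mu> \<nu> S \<longrightarrow> transport_cost \<mu> T \<le> transport_cost \<mu> S)"

text \<open>\<open>T\<close> represents the optimal transport from \<open>\<mu>\<close> to \<open>\<nu>\<close>: it is a minimizer, and
  it is the only one up to \<open>\<mu>\<close>-null sets.\<close>

definition is_optimal_transport :: "real measure \<Rightarrow> real measure \<Rightarrow> (real \<Rightarrow> real) \<Rightarrow> bool" where
  "is_optimal_transport \<mu> \<nu> T \<longleftrightarrow>
     is_minimizing_transport \<mu> \<nu> T \<and>
     (\<forall>S. is_minimizing_transport \<mu> \<nu> S \<longrightarrow> (AE x in \<mu>. S x = T x))"

text \<open>Extended logarithm: \<open>ln 0 = 0\<close> in HOL, which would make the bound on \<open>log T'\<close>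
  vacuous at points where \<open>T' = 0\<close>.\<close>

definition log_ext :: "real \<Rightarrow> ereal" where
  "log_ext y = (if y \<le> 0 then -\<infinity> else ereal (ln y))"

definition Linf_norm :: "(real \<Rightarrow> ereal) \<Rightarrow> ereal" where
  "Linf_norm f = esssup lebesgue (\<lambda>x. \<bar>f x\<bar>)"

end

theory Submission
  imports Defs
begin

text \<open>
  Write \<open>f = exp (- V)\<close> and \<open>g = f exp (- q)\<close> for the two densities, \<open>F\<close> and \<open>G\<close> for their
  distribution functions, and \<open>- B \<le> q \<le> A\<close> for the essential bounds of \<open>q\<close>. The optimal transport is
  the monotone map determined by \<open>G (T x) = F x\<close>, so formally \<open>T' x = f x / g (T x)\<close>. The factor
  \<open>exp (q (T x))\<close> contained in this quotient lies between \<open>exp (- B)\<close> and \<open>exp A\<close>, and the point is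
  that the remaining factor \<open>f x / f (T x)\<close> lies between \<open>exp (- A)\<close> and \<open>exp B\<close>.

  For a log-concave density the functions \<open>f / F\<close> and \<open>f / (1 - F)\<close> are nonincreasing and
  nondecreasing (\<open>log_concave_left_tail_ratio\<close>, \<open>log_concave_right_tail_ratio\<close>). As \<open>g\<close> and \<open>f\<close>
  differ by a factor between \<open>exp (- A)\<close> and \<open>exp B\<close>, so do \<open>G\<close> and \<open>F\<close>, and \<open>1 - G\<close> and \<open>1 - F\<close>.
  Evaluated at \<open>T x\<close>, where \<open>G (T x) = F x\<close>, this places the quotients of the values of \<open>F\<close>, and of
  those of \<open>1 - F\<close>, at \<open>T x\<close> and \<open>x\<close> between \<open>exp (- B)\<close> and \<open>exp A\<close>, and monotonicity carries the
  bounds over to \<open>f (T x) / f x\<close> (\<open>f_transport_ratio\<close>).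

  Since \<open>q\<close> is only measurable, \<open>G o T = F\<close> cannot be differentiated directly. Instead, testing
  the transport of \<open>f dx\<close> to \<open>g dy\<close> against \<open>1 / g\<close> on intervals shows that \<open>T\<close> is the indefinite
  integral of \<open>f / (g o T)\<close> (\<open>T_indefinite_integral\<close>). This gives the Lipschitz bound at once, and
  the derivative almost everywhere by Lebesgue's differentiation theorem
  (\<open>AE_has_derivative_indefinite_integral\<close>), which is proved here from Vitali's covering theorem.

  That the monotone map \<open>T\<close> is the unique minimizer of the quadratic cost follows from convexity of
  an antiderivative of \<open>T\<close> (\<open>increasing_lipschitz_transport_optimal\<close>). The costs are finite because
  log-concave densities decay exponentially (\<open>log_concave_second_moment\<close>).
\<close>

section \<open>Almost everywhere differentiability of indefinite integrals\<close>

text \<open>The Vitali covering argument behind Lebesgue's theorem. Let \<open>E\<close> be a bounded piece of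
  \<open>{w \<le> b}\<close> and let \<open>U\<close> be an open set around \<open>E\<close> with \<open>U - E\<close> small. The bad points of \<open>E\<close>
  are covered, up to a null set, by disjoint intervals inside \<open>U\<close> on which \<open>w\<close> has mean above
  \<open>c > b\<close>. Since \<open>w \<le> b\<close> on \<open>E\<close>, the surplus can only come from \<open>U - E\<close>, where \<open>w \<le> M\<close>; hence
  the union of the intervals meets \<open>E\<close> in a set whose measure is at most a constant times that of
  \<open>U - E\<close>.\<close>

lemma negligible_large_upper_derivate:
  fixes w T :: "real \<Rightarrow> real"
  assumes [measurable]: "w \<in> borel_measurable borel"
    and w: "\<And>x. 0 \<le> w x" "\<And>x. w x \<le> M"
    and T: "\<And>u v. u \<le> v \<Longrightarrow> (w has_integral (T v - T u)) {u..v}"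
    and bc: "b < c"
  shows "negligible {x. w x \<le> b \<and>
           (\<forall>d>0. \<exists>u v. u < v \<and> u \<le> x \<and> x \<le> v \<and> v - u < d \<and> c * (v - u) < T v - T u)}"
    (is "negligible ?S")
proof (cases "0 \<le> b")
  case False
  then have "\<not> w x \<le> b" for x using w(1)[of x] by linarith
  then have empty: "?S = {}" by simp
  show ?thesis by (simp only: empty negligible_empty)
next
  case True
  then have c: "0 < c" and M: "0 \<le> M" using bc w[of 0] by auto
  define N where "N = density lborel (\<lambda>x. ennreal (w x))"
  have N_Icc: "emeasure N {u..v} = ennreal (T v - T u)" if "u \<le> v" for u v
    unfolding N_def
    using nn_integral_has_integral_lebesgue'[OF w(1) T[OF that]] by (simp add: emeasure_density)
  show ?thesis
  proof (subst negligible_on_intervals, intro allI)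
    fix p q :: real
    define E where "E = {x. w x \<le> b} \<inter> {p..q}"
    have E [measurable]: "E \<in> sets borel" unfolding E_def by measurable
    show "negligible (?S \<inter> cbox p q)"
    proof (subst negligible_outer_le, intro allI impI)
      fix e :: real assume e: "e > 0"
      \<comment> \<open>chosen so that \<open>(c - b) m \<le> M \<epsilon>\<close> below forces \<open>m \<le> e\<close>, also when \<open>M = 0\<close>\<close>
      define \<epsilon> where "\<epsilon> = (c - b) * e / (M + 1)"
      have \<epsilon>: "\<epsilon> > 0" using bc e M by (simp add: \<epsilon>_def)
      obtain U where U: "open U" "E \<subseteq> U" and UE: "emeasure lebesgue (U - E) < ennreal \<epsilon>"
        using sets_lebesgue_outer_open[of E \<epsilon>] E \<epsilon> by (auto simp: sets_completionI_sets)
      have [measurable]: "U \<in> sets borel" using U(1) by (rule borel_open)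
      define K where "K = {i. fst i < snd i \<and> {fst i..snd i} \<subseteq> U \<and> c * (snd i - fst i) < T (snd i) - T (fst i)}"
      define a r where "a = (\<lambda>i::real\<times>real. (fst i + snd i) / 2)" and "r = (\<lambda>i::real\<times>real. (snd i - fst i) / 2)"
      have cb: "cball (a i) (r i) = {fst i..snd i}" for i
        unfolding a_def r_def cball_eq_atLeastAtMost by (simp add: field_simps)
      obtain C where C: "countable C" "C \<subseteq> K"
          and dis: "pairwise (\<lambda>i j. disjnt (cball (a i) (r i)) (cball (a j) (r j))) C"
          and neg: "negligible (?S \<inter> cbox p q - (\<Union>i\<in>C. cball (a i) (r i)))"
      proof (rule Vitali_covering_theorem_cballs[of K r "?S \<inter> cbox p q" a])
        show "0 < r i" if "i \<in> K" for i using that by (auto simp: K_def r_def)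
      next
        fix x d :: real assume x: "x \<in> ?S \<inter> cbox p q" and d: "0 < d"
        then have "x \<in> U" using U by (auto simp: E_def)
        then obtain d' where d': "d' > 0" "ball x d' \<subseteq> U"
          using U(1) openE by blast
        from x have "\<forall>e>0. \<exists>u v. u < v \<and> u \<le> x \<and> x \<le> v \<and> v - u < e \<and> c * (v - u) < T v - T u"
          by blast
        moreover have "0 < min d d'" using d d' by simp
        ultimately obtain u v where
          uv: "u < v" "u \<le> x" "x \<le> v" "v - u < min d d'" "c * (v - u) < T v - T u"
          by blast
        have "{u..v} \<subseteq> ball x d'" using uv by (auto simp: dist_real_def)
        then have "(u, v) \<in> K" using uv d' by (auto simp: K_def)
        then show "\<exists>i. i \<in> K \<and> x \<in> cball (a i) (r i) \<and> r i < d"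
          using uv by (intro exI[of _ "(u, v)"]) (auto simp: cb, auto simp: r_def)
      qed
      define X where "X = (\<Union>i\<in>C. {fst i..snd i})"
      have X [measurable]: "X \<in> sets borel"
        unfolding X_def using C(1) by (intro sets.countable_UN') auto
      have XU: "X \<subseteq> U" using C(2) by (auto simp: X_def K_def)
      have djf: "disjoint_family_on (\<lambda>i. {fst i..snd i}) C"
        using dis by (auto simp: disjoint_family_on_def pairwise_def disjnt_def cb)
      have "ennreal c * emeasure lborel X \<le> emeasure N X"
      proof -
        have "ennreal c * emeasure lborel X = ennreal c * (\<integral>\<^sup>+i. emeasure lborel {fst i..snd i} \<partial>count_space C)"
          unfolding X_def using C(1) djf by (subst emeasure_UN_countable) auto
        also have "\<dots> = (\<integral>\<^sup>+i. ennreal c * emeasure lborel {fst i..snd i} \<partial>count_space C)"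
          by (simp add: nn_integral_cmult)
        also have "\<dots> \<le> (\<integral>\<^sup>+i. emeasure N {fst i..snd i} \<partial>count_space C)"
        proof (rule nn_integral_mono)
          fix i assume "i \<in> space (count_space C)"
          then have "fst i < snd i" "c * (snd i - fst i) < T (snd i) - T (fst i)" using C(2) by (auto simp: K_def)
          then show "ennreal c * emeasure lborel {fst i..snd i} \<le> emeasure N {fst i..snd i}"
            using c by (auto simp: N_Icc ennreal_mult'[symmetric] intro!: ennreal_leI)
        qed
        also have "\<dots> = emeasure N X"
          unfolding X_def using C(1) djf by (subst emeasure_UN_countable) (auto simp: N_def)
        finally show ?thesis .
      qed
      also have "emeasure N X \<le> (\<integral>\<^sup>+x. ennreal b * indicator (X \<inter> E) x + ennreal M * indicator (U - E) x \<partial>lborel)"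
      proof -
        have "ennreal (w x) * indicator X x \<le> ennreal b * indicator (X \<inter> E) x + ennreal M * indicator (U - E) x" for x
          using w[of x] XU True by (auto simp: indicator_def E_def intro!: ennreal_leI)
        then show ?thesis
          unfolding N_def by (subst emeasure_density) (auto intro!: nn_integral_mono)
      qed
      also have "\<dots> = ennreal b * emeasure lborel (X \<inter> E) + ennreal M * emeasure lborel (U - E)"
        by (subst nn_integral_add) (auto simp: nn_integral_cmult)
      finally have ineq: "ennreal c * emeasure lborel X \<le>
          ennreal b * emeasure lborel (X \<inter> E) + ennreal M * emeasure lborel (U - E)" .
      have fin: "emeasure lborel (X \<inter> E) < \<infinity>"
      proof -
        have "emeasure lborel (X \<inter> E) \<le> emeasure lborel {p..q}"
          by (rule emeasure_mono) (auto simp: E_def)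
        also have "\<dots> < \<infinity>" by (simp add: emeasure_lborel_Icc_eq)
        finally show ?thesis .
      qed
      define m where "m = measure lborel (X \<inter> E)"
      have m: "emeasure lborel (X \<inter> E) = ennreal m" "0 \<le> m"
        using fin by (auto simp: m_def emeasure_eq_ennreal_measure)
      have "ennreal (c * m) \<le> ennreal c * emeasure lborel X"
        using c m by (auto simp: ennreal_mult' m(1)[symmetric] intro!: mult_left_mono emeasure_mono)
      also note ineq
      also have "ennreal b * emeasure lborel (X \<inter> E) + ennreal M * emeasure lborel (U - E)
           \<le> ennreal b * ennreal m + ennreal M * ennreal \<epsilon>"
        using UE U(1) E by (intro add_mono mult_left_mono) (auto simp: m)
      also have "\<dots> = ennreal (b * m + M * \<epsilon>)"
        using True M m \<epsilon> by (simp add: ennreal_mult ennreal_plus)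
      finally have "c * m \<le> b * m + M * \<epsilon>"
        using True M m \<epsilon> by (subst (asm) ennreal_le_iff) auto
      then have "(c - b) * m \<le> M * \<epsilon>" by (simp add: algebra_simps)
      also have "\<dots> \<le> (M + 1) * \<epsilon>" using \<epsilon> by (simp add: algebra_simps)
      also have "\<dots> = (c - b) * e" using M by (simp add: \<epsilon>_def)
      finally have me: "m \<le> e" using bc by (simp add: mult_le_cancel_left_pos)
      define Z where "Z = ?S \<inter> cbox p q - X"
      have Z: "negligible Z" using neg by (simp add: cb X_def Z_def)
      have XE: "X \<inter> E \<in> lmeasurable"
        using fin by (auto simp: fmeasurable_def)
      have "measure lebesgue ((X \<inter> E) \<union> Z) = measure lebesgue (X \<inter> E)"
        using Z XE by (intro measure_Un_null_set) (auto simp: negligible_iff_null_sets)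
      then have "measure lebesgue ((X \<inter> E) \<union> Z) \<le> e"
        using me by (simp add: m_def)
      moreover have "?S \<inter> cbox p q \<subseteq> (X \<inter> E) \<union> Z"
        by (auto simp: Z_def E_def)
      moreover have "(X \<inter> E) \<union> Z \<in> lmeasurable"
        using XE Z negligible_imp_measurable by auto
      ultimately show "\<exists>T. ?S \<inter> cbox p q \<subseteq> T \<and> T \<in> lmeasurable \<and> measure lebesgue T \<le> e"
        by blast
    qed
  qed
qed

text \<open>Bad points for the upper derivate of \<open>T\<close> at \<open>w\<close> are null by the previous lemma, used for all
  rational thresholds. Bad points for the lower derivate are those for the upper derivate of
  \<open>M x - T x\<close>, the indefinite integral of \<open>M - w \<ge> 0\<close>.\<close>

lemma AE_has_derivative_indefinite_integral:
  fixes w T :: "real \<Rightarrow> real"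
  assumes [measurable]: "w \<in> borel_measurable borel"
    and w: "\<And>x. 0 \<le> w x" "\<And>x. w x \<le> M"
    and T: "\<And>u v. u \<le> v \<Longrightarrow> (w has_integral (T v - T u)) {u..v}"
  shows "AE x in lebesgue. (T has_real_derivative w x) (at x)"
proof -
  define Bad where "Bad = (\<lambda>w T b c. {x::real. w x \<le> (b::real) \<and>
           (\<forall>d>0. \<exists>u v. u < v \<and> u \<le> x \<and> x \<le> v \<and> v - u < d \<and> c * (v - u) < T v - (T u::real))})"
  define w' T' where "w' = (\<lambda>x. M - w x)" and "T' = (\<lambda>x. M * x - T x)"
  have T': "(w' has_integral (T' v - T' u)) {u..v}" if "u \<le> v" for u v
  proof -
    have "((\<lambda>x. M - w x) has_integral (M * (v - u) - (T v - T u))) {u..v}"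
      using has_integral_const_real[of M u v] that
      by (intro has_integral_diff T) (auto simp: mult.commute)
    then show ?thesis by (simp add: w'_def T'_def algebra_simps)
  qed
  have n1: "negligible (Bad w T b c)" if "b < c" for b c
    unfolding Bad_def by (rule negligible_large_upper_derivate[OF _ w T that]) auto
  have n2: "negligible (Bad w' T' b c)" if "b < c" for b c
    unfolding Bad_def by (rule negligible_large_upper_derivate[OF _ _ _ T' that, of M]) (use w in \<open>auto simp: w'_def\<close>)
  define P where "P = {(b, c). b \<in> \<rat> \<and> c \<in> \<rat> \<and> b < (c::real)}"
  have "P \<subseteq> \<rat> \<times> \<rat>" by (auto simp: P_def)
  then have cP: "countable P" using countable_rat by (meson countable_SIGMA countable_subset)
  define Z where "Z = (\<Union>(b, c)\<in>P. Bad w T b c \<union> Bad w' T' b c)"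
  have "negligible Z"
    unfolding Z_def by (intro negligible_countable_Union countable_image cP) (auto simp: P_def n1 n2)
  then have "AE x in lebesgue. x \<notin> Z"
    by (intro AE_not_in) (simp add: negligible_iff_null_sets)
  then show ?thesis
  proof eventually_elim
    fix x assume x: "x \<notin> Z"
    have upper: "\<exists>d>0. \<forall>u v. u < v \<longrightarrow> u \<le> x \<longrightarrow> x \<le> v \<longrightarrow> v - u < d \<longrightarrow> S v - S u \<le> (g x + e) * (v - u)"
      if S: "\<And>b c. (b, c) \<in> P \<Longrightarrow> x \<notin> Bad g S b c" and e: "e > 0" for g S :: "real \<Rightarrow> real" and e
    proof -
      obtain b where b: "b \<in> \<rat>" "g x < b" "b < g x + e"
        using Rats_dense_in_real[of "g x" "g x + e"] e by auto
      obtain c where c: "c \<in> \<rat>" "b < c" "c < g x + e"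
        using Rats_dense_in_real[of b "g x + e"] b by auto
      have "x \<notin> Bad g S b c" using S b c by (auto simp: P_def)
      then obtain d where d: "d > 0"
        "\<And>u v. u < v \<Longrightarrow> u \<le> x \<Longrightarrow> x \<le> v \<Longrightarrow> v - u < d \<Longrightarrow> S v - S u \<le> c * (v - u)"
        using b unfolding Bad_def mem_Collect_eq by (metis less_imp_le not_less)
      have "S v - S u \<le> (g x + e) * (v - u)" if "u < v" "u \<le> x" "x \<le> v" "v - u < d" for u v
        using d(2)[OF that] c that by (smt (verit) mult_right_mono)
      then show ?thesis using d(1) by blast
    qed
    show "(T has_real_derivative w x) (at x)"
      unfolding has_field_derivative_iff
    proof (rule LIM_I)
      fix r :: real assume r: "0 < r"
      then have r2: "r/2 > 0" by simp
      obtain d1 where d1: "d1 > 0" "\<And>u v. u < v \<Longrightarrow> u \<le> x \<Longrightarrow> x \<le> v \<Longrightarrow> v - u < d1 \<Longrightarrow> T v - T u \<le> (w x + r/2) * (v - u)"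
        using upper[of w T, OF _ r2] x by (auto simp: Z_def)
      obtain d2 where d2: "d2 > 0" "\<And>u v. u < v \<Longrightarrow> u \<le> x \<Longrightarrow> x \<le> v \<Longrightarrow> v - u < d2 \<Longrightarrow> T' v - T' u \<le> (w' x + r/2) * (v - u)"
        using upper[of w' T', OF _ r2] x by (auto simp: Z_def)
      have est: "\<bar>(T v - T u) / (v - u) - w x\<bar> < r" if "u < v" "u \<le> x" "x \<le> v" "v - u < min d1 d2" for u v
      proof -
        have "T v - T u \<le> (w x + r/2) * (v - u)" using d1(2) that by auto
        moreover have "T v - T u \<ge> (w x - r/2) * (v - u)"
          using d2(2)[of u v] that by (auto simp: T'_def w'_def algebra_simps)
        ultimately have "(T v - T u) / (v - u) \<le> w x + r/2" "(T v - T u) / (v - u) \<ge> w x - r/2"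
          using that by (simp_all add: pos_divide_le_eq pos_le_divide_eq)
        then show ?thesis using r by linarith
      qed
      show "\<exists>s>0. \<forall>y. y \<noteq> x \<and> norm (y - x) < s \<longrightarrow> norm ((T y - T x) / (y - x) - w x) < r"
      proof (intro exI[of _ "min d1 d2"] conjI allI impI)
        fix y assume y: "y \<noteq> x \<and> norm (y - x) < min d1 d2"
        show "norm ((T y - T x) / (y - x) - w x) < r"
        proof (cases "x < y")
          case True
          then show ?thesis using est[of x y] y by auto
        next
          case False
          moreover have "(T y - T x) / (y - x) = (T x - T y) / (x - y)"
            by (metis minus_diff_eq minus_divide_divide)
          ultimately show ?thesis using est[of y x] y by auto
        qed
      qed (use d1 d2 in auto)
    qed
  qed
qed

section \<open>Log-concave densities\<close>

text \<open>Log-concavity without logarithms, so that zeros need no case distinction: where \<open>f x\<close> or \<open>f y\<close>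
  vanishes, so does the left-hand side, because \<open>0 powr a = 0\<close> for every \<open>a\<close>.\<close>

definition log_concave :: "(real \<Rightarrow> real) \<Rightarrow> bool" where
  "log_concave f \<longleftrightarrow> (\<forall>x. 0 \<le> f x) \<and>
     (\<forall>x y. \<forall>u\<ge>0. \<forall>v\<ge>0. u + v = 1 \<longrightarrow> f x powr u * f y powr v \<le> f (u * x + v * y))"

lemma log_concave_nonneg: "log_concave f \<Longrightarrow> 0 \<le> f x"
  by (simp add: log_concave_def)

lemma log_concaveD:
  "log_concave f \<Longrightarrow> 0 \<le> u \<Longrightarrow> 0 \<le> v \<Longrightarrow> u + v = 1 \<Longrightarrow> f x powr u * f y powr v \<le> f (u * x + v * y)"
  by (simp add: log_concave_def)

lemma log_concave_exp_neg:
  assumes "convex_extended V"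
  shows "log_concave (\<lambda>x. exp_neg (V x))"
  unfolding log_concave_def
proof (intro conjI allI impI)
  show "0 \<le> exp_neg (V x)" for x by (simp add: exp_neg_def)
next
  fix x y u v :: real assume uv: "0 \<le> u" "0 \<le> v" "u + v = 1"
  show "exp_neg (V x) powr u * exp_neg (V y) powr v \<le> exp_neg (V (u * x + v * y))"
  proof (cases "V x = \<infinity> \<or> V y = \<infinity>")
    case True
    then show ?thesis by (auto simp: exp_neg_def)
  next
    case False
    moreover have "V x \<noteq> -\<infinity>" "V y \<noteq> -\<infinity>" and nm: "V (u * x + v * y) \<noteq> -\<infinity>"
      using assms by (auto simp: convex_extended_def)
    ultimately obtain a b where ab: "V x = ereal a" "V y = ereal b"
      by (metis ereal_cases)
    have "V (u * x + v * y) \<le> ereal u * V x + ereal v * V y"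
      using assms uv by (auto simp: convex_extended_def)
    then have "V (u * x + v * y) \<le> ereal (u * a + v * b)" by (simp add: ab)
    with nm obtain c where c: "V (u * x + v * y) = ereal c" "c \<le> u * a + v * b"
      by (cases "V (u * x + v * y)") auto
    have "exp_neg (V x) powr u * exp_neg (V y) powr v = exp (- (u * a + v * b))"
      by (simp add: ab exp_neg_def exp_powr_real exp_add[symmetric] algebra_simps)
    also have "\<dots> \<le> exp (- c)" using c by simp
    finally show ?thesis by (simp add: c exp_neg_def)
  qed
qed

lemma log_concave_reflect:
  assumes "log_concave f" shows "log_concave (\<lambda>x. f (- x))"
  unfolding log_concave_def
proof (intro conjI allI impI)
  show "0 \<le> f (- x)" for x by (rule log_concave_nonneg[OF assms])
next
  fix x y u v :: real assume "0 \<le> u" "0 \<le> v" "u + v = 1"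
  then show "f (- x) powr u * f (- y) powr v \<le> f (- (u * x + v * y))"
    using log_concaveD[OF assms, of u v "- x" "- y"] by simp
qed

text \<open>All superlevel sets are convex, hence intervals.\<close>

lemma log_concave_measurable:
  assumes f: "log_concave f" shows "f \<in> borel_measurable borel"
  unfolding borel_measurable_iff_ge
proof
  fix c
  show "{x \<in> space borel. c \<le> f x} \<in> sets borel"
  proof (cases "0 < c")
    case False
    then have "{x \<in> space borel. c \<le> f x} = UNIV"
      using log_concave_nonneg[OF f] by (auto simp: not_less intro: order_trans)
    then show ?thesis by simp
  next
    case True
    have "convex {x. c \<le> f x}"
    proof (rule convexI, simp)
      fix x y u v :: real assume *: "c \<le> f x" "c \<le> f y" "0 \<le> u" "0 \<le> v" "u + v = 1"
      have "c = c powr u * c powr v" using True * by (simp add: powr_add[symmetric])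
      also have "\<dots> \<le> f x powr u * f y powr v"
        using True * by (intro mult_mono powr_mono2) auto
      also have "\<dots> \<le> f (u * x + v * y)" using log_concaveD[OF f] * by blast
      finally show "c \<le> f (u * x + v * y)" .
    qed
    then have "is_interval {x. c \<le> f x}" by (simp only: is_interval_convex_1)
    then show ?thesis by (simp add: real_interval_borel_measurable)
  qed
qed

text \<open>Moving two points towards each other while keeping their sum fixed increases the product:
  both inner points are convex combinations of \<open>a\<close> and \<open>b\<close>, with swapped weights.\<close>

lemma log_concave_cross:
  assumes f: "log_concave f" and "a \<le> p" "p \<le> b"
  shows "f a * f b \<le> f p * f (a + b - p)"
proof (cases "a = b")
  case True
  then show ?thesis using assms by simp
next
  case False
  define s where "s = (p - a) / (b - a)"
  have ab: "a < b" using False assms by auto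
  have s: "0 \<le> s" "s \<le> 1" using ab assms by (auto simp: s_def)
  have "s * (b - a) = p - a" using ab by (simp add: s_def)
  then have p: "(1 - s) * a + s * b = p" and q: "s * a + (1 - s) * b = a + b - p"
    by (simp_all add: algebra_simps)
  have "(f a powr (1 - s) * f b powr s) * (f a powr s * f b powr (1 - s)) \<le> f p * f (a + b - p)"
    using log_concaveD[OF f, of "1 - s" s a b] log_concaveD[OF f, of s "1 - s" a b] s
    unfolding p q by (intro mult_mono) (auto simp: log_concave_nonneg[OF f])
  moreover have "(f a powr (1 - s) * f b powr s) * (f a powr s * f b powr (1 - s)) = f a * f b"
    using log_concave_nonneg[OF f, of a] log_concave_nonneg[OF f, of b]
    by (simp add: mult.assoc mult.left_commute[of "f b powr s"] powr_add[symmetric])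
  ultimately show ?thesis by simp
qed

text \<open>With \<open>F\<close> the distribution function of \<open>f dx\<close>, this says that \<open>f / F\<close> is nonincreasing, or
  that \<open>J s / s\<close> is nonincreasing for the profile \<open>J = f o F\<inverse>\<close>. It suffices to
  compare the integrands \<open>f y f (x - t)\<close> and \<open>f x f (y - t)\<close>, which is the crossing inequality for
  \<open>x - t \<le> x, y - t \<le> y\<close>.\<close>

lemma log_concave_left_tail_ratio:
  assumes f: "log_concave f" and xy: "x \<le> y"
  shows "ennreal (f y) * emeasure (density lborel (\<lambda>z. ennreal (f z))) {..x}
    \<le> ennreal (f x) * emeasure (density lborel (\<lambda>z. ennreal (f z))) {..y}"
proof -
  note [measurable] = log_concave_measurable[OF f]
  have tail: "emeasure (density lborel (\<lambda>z. ennreal (f z))) {..a} =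
      (\<integral>\<^sup>+t. ennreal (f (a - t)) * indicator {0..} t \<partial>lborel)" for a
    by (subst emeasure_density, simp, simp, subst nn_integral_real_affine[where c="-1" and t=a])
       (auto intro!: nn_integral_cong simp: indicator_def)
  have "f y * f (x - t) \<le> f x * f (y - t)" if "0 \<le> t" for t
    using log_concave_cross[OF f, of "x - t" x y] xy that by (simp add: mult.commute)
  then have "ennreal (f y) * (ennreal (f (x - t)) * indicator {0..} t)
      \<le> ennreal (f x) * (ennreal (f (y - t)) * indicator {0..} t)" for t
    by (auto simp: indicator_def ennreal_mult'[symmetric] log_concave_nonneg[OF f] intro!: ennreal_leI)
  then show ?thesis
    unfolding tail by (subst (1 2) nn_integral_cmult[symmetric]) (auto intro!: nn_integral_mono)
qed

lemma log_concave_right_tail_ratio: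
  assumes f: "log_concave f" and xy: "x \<le> y"
  shows "ennreal (f x) * emeasure (density lborel (\<lambda>z. ennreal (f z))) {y..}
    \<le> ennreal (f y) * emeasure (density lborel (\<lambda>z. ennreal (f z))) {x..}"
proof -
  note [measurable] = log_concave_measurable[OF f]
  have tail: "emeasure (density lborel (\<lambda>z. ennreal (f z))) {a..} =
      emeasure (density lborel (\<lambda>z. ennreal (f (- z)))) {..-a}" for a
    by (subst (1 2) emeasure_density, simp_all, subst nn_integral_real_affine[where c="-1" and t=0])
       (auto intro!: nn_integral_cong simp: indicator_def)
  show ?thesis
    using log_concave_left_tail_ratio[OF log_concave_reflect[OF f], of "-y" "-x"] xy
    by (simp add: tail)
qed

text \<open>Integrability forces \<open>f\<close> to drop somewhere to the right of a point where it is positive, and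
  by log-concavity it then keeps decaying at least at the exponential rate of that drop.\<close>

lemma log_concave_second_moment_right:
  assumes f: "log_concave f" and fin: "(\<integral>\<^sup>+x. ennreal (f x) \<partial>lborel) < \<infinity>"
  shows "(\<integral>\<^sup>+x. ennreal (f x * x\<^sup>2) * indicator {0..} x \<partial>lborel) < \<infinity>"
proof (cases "\<exists>x0. 0 < f x0")
  case False
  have zero: "f x = 0" for x
  proof -
    have "\<not> 0 < f x" using False by blast
    then show ?thesis using log_concave_nonneg[OF f, of x] by linarith
  qed
  show ?thesis by (simp add: zero)
next
  case True
  then obtain x0 where x0: "0 < f x0" by blast
  note [measurable] = log_concave_measurable[OF f]
  have "\<exists>x1>max 0 x0. f x1 < f x0"
  proof (rule ccontr)
    assume "\<not> ?thesis"
    then have *: "f x0 \<le> f x" if "max 0 x0 < x" for x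
      using that by (meson not_less)
    have "(\<integral>\<^sup>+x. ennreal (f x0) * indicator {max 0 x0<..} x \<partial>lborel) \<le> (\<integral>\<^sup>+x. ennreal (f x) \<partial>lborel)"
      using * by (intro nn_integral_mono) (auto simp: indicator_def intro!: ennreal_leI)
    also note fin
    finally have "ennreal (f x0) * emeasure lborel {max 0 x0<..} < \<infinity>"
      by (simp add: nn_integral_cmult)
    then have "emeasure lborel {max 0 x0<..} < \<infinity>"
      using x0 by (auto simp: ennreal_mult_less_top)
    then obtain m where m: "emeasure lborel {max 0 x0<..} = ennreal m" "0 \<le> m"
      by (auto simp: less_top_ennreal)
    have "emeasure lborel {max 0 x0<..max 0 x0 + (m + 1)} \<le> emeasure lborel {max 0 x0<..}"
      by (intro emeasure_mono) auto
    then show False using m by simp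
  qed
  then obtain x1 where x1: "0 < x1" "x0 < x1" "f x1 < f x0" by auto
  define \<rho> where "\<rho> = f x1 / f x0"
  have \<rho>: "0 \<le> \<rho>" "\<rho> < 1" using x0 x1 log_concave_nonneg[OF f, of x1] by (auto simp: \<rho>_def)
  \<comment> \<open>the exponential rate of the drop from \<open>x0\<close> to \<open>x1\<close>; if \<open>f x1 = 0\<close>, then \<open>f\<close> vanishes beyond
    \<open>x1\<close> and any positive rate will do\<close>
  define l where "l = (if \<rho> = 0 then 1 else - ln \<rho> / (x1 - x0))"
  have l: "0 < l"
  proof (cases "\<rho> = 0")
    case False
    then have "ln \<rho> < 0" using \<rho> by simp
    then show ?thesis using False x1 by (simp add: l_def divide_neg_pos)
  qed (simp add: l_def)
  have decay: "f x \<le> f x0 * exp (- (l * (x - x0)))" if x: "x1 \<le> x" for x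
  proof (cases "f x = 0")
    case True
    then show ?thesis using x0 by simp
  next
    case False
    then have fx: "0 < f x" using log_concave_nonneg[OF f, of x] by simp
    define s where "s = (x1 - x0) / (x - x0)"
    have s: "0 < s" "s \<le> 1" using x x1 by (auto simp: s_def)
    have "s * (x - x0) = x1 - x0" using x x1 by (simp add: s_def)
    then have "(1 - s) * x0 + s * x = x1" by (simp add: algebra_simps)
    then have le: "f x0 powr (1 - s) * f x powr s \<le> f x1"
      using log_concaveD[OF f, of "1 - s" s x0 x] s by simp
    moreover have pos: "0 < f x0 powr (1 - s) * f x powr s" using x0 fx by simp
    ultimately have fx1: "0 < f x1" by linarith
    then have \<rho>0: "0 < \<rho>" using x0 by (simp add: \<rho>_def)
    have "ln (f x0 powr (1 - s) * f x powr s) \<le> ln (f x1)" using le pos fx1 by simp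
    then have "(1 - s) * ln (f x0) + s * ln (f x) \<le> ln (f x1)"
      using x0 fx by (simp add: ln_mult ln_powr)
    then have "s * (ln (f x) - ln (f x0)) \<le> ln \<rho>"
      using x0 fx1 by (simp add: \<rho>_def ln_div algebra_simps)
    then have "(ln (f x) - ln (f x0)) \<le> ln \<rho> / s" using s by (simp add: pos_le_divide_eq mult.commute)
    also have "ln \<rho> / s = - (l * (x - x0))" using \<rho>0 x x1 by (simp add: l_def s_def)
    finally have "ln (f x) \<le> ln (f x0) + - (l * (x - x0))" by simp
    then have "exp (ln (f x)) \<le> exp (ln (f x0) + - (l * (x - x0)))" by (subst exp_le_cancel_iff)
    then show ?thesis by (simp only: exp_add exp_ln[OF fx] exp_ln[OF x0])
  qed
  \<comment> \<open>turns the exponential bound into a multiple of the exponential density of rate \<open>l\<close>, whose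
    moments are known\<close>
  define K where "K = f x0 * exp (l * x0) / l"
  have K: "0 \<le> K" using x0 l by (simp add: K_def)
  have bound: "ennreal (f x * x\<^sup>2) * indicator {0..} x \<le>
      ennreal (x1\<^sup>2) * ennreal (f x) + ennreal K * ennreal (erlang_density 0 l x * x ^ 2)" for x
  proof (cases "0 \<le> x")
    case True
    show ?thesis
    proof (cases "x1 \<le> x")
      case True
      have "f x * x\<^sup>2 \<le> (f x0 * exp (- (l * (x - x0)))) * x\<^sup>2"
        using decay[OF True] by (intro mult_right_mono) auto
      also have "\<dots> = K * (erlang_density 0 l x * x ^ 2)"
        using True x1 l by (simp add: K_def erlang_density_def exp_add[symmetric] algebra_simps)
      finally have "f x * x\<^sup>2 \<le> K * (erlang_density 0 l x * x ^ 2)" .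
      then have "ennreal (f x * x\<^sup>2) \<le> ennreal K * ennreal (erlang_density 0 l x * x ^ 2)"
        using K by (simp add: ennreal_mult'[symmetric] ennreal_leI)
      then show ?thesis using True x1 by (simp add: add_increasing)
    next
      case False
      then have "f x * x\<^sup>2 \<le> x1\<^sup>2 * f x" using \<open>0 \<le> x\<close> log_concave_nonneg[OF f, of x]
        by (subst mult.commute) (intro mult_right_mono power_mono, auto)
      then have "ennreal (f x * x\<^sup>2) \<le> ennreal (x1\<^sup>2) * ennreal (f x)"
        by (simp add: ennreal_mult'[symmetric] ennreal_leI)
      then show ?thesis using \<open>0 \<le> x\<close> by (simp add: add_increasing2)
    qed
  next
    case False
    then have "indicator {0..} x = (0 :: ennreal)" by simp
    then show ?thesis by (simp only: mult_zero_right zero_le)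
  qed
  have moment: "(\<integral>\<^sup>+x. ennreal (erlang_density 0 l x * x ^ 2) \<partial>lborel) < \<infinity>"
    using nn_integral_erlang_ith_moment[OF l, of 0 2] by simp
  have "(\<integral>\<^sup>+x. ennreal (f x * x\<^sup>2) * indicator {0..} x \<partial>lborel) \<le>
     (\<integral>\<^sup>+x. ennreal (x1\<^sup>2) * ennreal (f x) + ennreal K * ennreal (erlang_density 0 l x * x ^ 2) \<partial>lborel)"
    by (rule nn_integral_mono) (rule bound)
  also have "\<dots> = (\<integral>\<^sup>+x. ennreal (x1\<^sup>2) * ennreal (f x) \<partial>lborel) +
      (\<integral>\<^sup>+x. ennreal K * ennreal (erlang_density 0 l x * x ^ 2) \<partial>lborel)"
    by (rule nn_integral_add) measurable
  also have "\<dots> = ennreal (x1\<^sup>2) * (\<integral>\<^sup>+x. ennreal (f x) \<partial>lborel) +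
      ennreal K * (\<integral>\<^sup>+x. ennreal (erlang_density 0 l x * x ^ 2) \<partial>lborel)"
    by (intro arg_cong2[where f="(+)"] nn_integral_cmult) measurable
  also have "\<dots> < \<infinity>" using fin moment by (simp add: ennreal_mult_less_top)
  finally show ?thesis .
qed

lemma log_concave_second_moment:
  assumes f: "log_concave f" and fin: "(\<integral>\<^sup>+x. ennreal (f x) \<partial>lborel) < \<infinity>"
  shows "(\<integral>\<^sup>+x. ennreal (f x * x\<^sup>2) \<partial>lborel) < \<infinity>"
proof -
  note [measurable] = log_concave_measurable[OF f]
  have "(\<integral>\<^sup>+x. ennreal (f (- x)) \<partial>lborel) = (\<integral>\<^sup>+x. ennreal (f x) \<partial>lborel)"
    by (subst (2) nn_integral_real_affine[where c="-1" and t=0]) auto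
  then have "(\<integral>\<^sup>+x. ennreal (f (- x) * x\<^sup>2) * indicator {0..} x \<partial>lborel) < \<infinity>"
    using log_concave_second_moment_right[OF log_concave_reflect[OF f]] fin by simp
  also have "(\<integral>\<^sup>+x. ennreal (f (- x) * x\<^sup>2) * indicator {0..} x \<partial>lborel)
      = (\<integral>\<^sup>+x. ennreal (f x * x\<^sup>2) * indicator {..0} x \<partial>lborel)"
    by (subst (2) nn_integral_real_affine[where c="-1" and t=0])
       (auto intro!: nn_integral_cong simp: indicator_def)
  finally have left: "(\<integral>\<^sup>+x. ennreal (f x * x\<^sup>2) * indicator {..0} x \<partial>lborel) < \<infinity>" .
  have "(\<integral>\<^sup>+x. ennreal (f x * x\<^sup>2) \<partial>lborel) \<le>
     (\<integral>\<^sup>+x. ennreal (f x * x\<^sup>2) * indicator {..0} x + ennreal (f x * x\<^sup>2) * indicator {0..} x \<partial>lborel)"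
    by (intro nn_integral_mono) (auto simp: indicator_def)
  also have "\<dots> < \<infinity>"
    using left log_concave_second_moment_right[OF f fin] by (subst nn_integral_add) auto
  finally show ?thesis .
qed

section \<open>Optimality of increasing transport maps\<close>

lemma increasing_antiderivative_above_tangents:
  fixes \<phi> T :: "real \<Rightarrow> real"
  assumes T: "strict_mono T" and \<phi>: "\<And>x. (\<phi> has_real_derivative T x) (at x)" and "x \<noteq> z"
  shows "0 < \<phi> x - \<phi> z - T z * (x - z)"
proof (cases "x < z")
  case True
  then obtain \<xi> where \<xi>: "x < \<xi>" "\<xi> < z" "\<phi> z - \<phi> x = (z - x) * T \<xi>"
    using MVT2[of x z \<phi> T] \<phi> by blast
  then have "(T z - T \<xi>) * (z - x) > 0" using True T by (simp add: strict_mono_def)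
  then show ?thesis using \<xi>(3) by (simp add: algebra_simps)
next
  case False
  then have "z < x" using assms by simp
  then obtain \<xi> where \<xi>: "z < \<xi>" "\<xi> < x" "\<phi> x - \<phi> z = (x - z) * T \<xi>"
    using MVT2[of z x \<phi> T] \<phi> by blast
  then have "(T \<xi> - T z) * (x - z) > 0" using \<open>z < x\<close> T by (simp add: strict_mono_def)
  then show ?thesis using \<xi>(3) by (simp add: algebra_simps)
qed

text \<open>Kantorovich duality in explicit form. Let \<open>\<phi>\<close> be an antiderivative of \<open>T\<close>; it is convex because
  \<open>T\<close> increases, and \<open>D x z = \<phi> x - \<phi> z - T z (x - z) \<ge> 0\<close> with equality only for \<open>x = z\<close>. Completing
  the square gives \<open>(x - T z)\<^sup>2 = a x + b z + 2 D x z\<close>. Any other transport map can be written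
  \<open>S = T o R\<close> with \<open>R = T\<inverse> o S\<close>, and \<open>R\<close> preserves \<open>\<mu>\<close>; so the
  integral of \<open>a x + b (R x)\<close> does not depend on \<open>S\<close>, and the cost of \<open>S\<close> exceeds that of \<open>T\<close> by
  twice the integral of \<open>D x (R x)\<close>.\<close>

lemma increasing_lipschitz_transport_optimal:
  fixes \<mu> \<nu> :: "real measure" and T :: "real \<Rightarrow> real"
  assumes prob: "prob_space \<mu>" and sets [measurable_cong]: "sets \<mu> = sets borel"
    and second_moment: "(\<integral>\<^sup>+x. ennreal (x\<^sup>2) \<partial>\<mu>) < \<infinity>"
    and T: "strict_mono T" "surj T" "L-lipschitz_on UNIV T"
    and push: "distr \<mu> borel T = \<nu>"
  shows "is_optimal_transport \<mu> \<nu> T"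
proof -
  interpret prob_space \<mu> by (rule prob)
  have contT: "continuous_on UNIV T" using T(3) by (rule lipschitz_on_continuous_on)
  then have [measurable]: "T \<in> borel_measurable borel" by (rule borel_measurable_continuous_onI)
  define U where "U = inv T"
  have TU: "T (U y) = y" for y using T(2) by (simp add: U_def surj_f_inv_f)
  have UT: "U (T x) = x" for x using T(1) by (simp add: U_def strict_mono_imp_inj_on)
  have "mono U"
  proof (rule monoI)
    fix a b :: real assume "a \<le> b"
    then have "T (U a) \<le> T (U b)" by (simp add: TU)
    then show "U a \<le> U b" using T(1) by (simp add: strict_mono_less_eq)
  qed
  then have [measurable]: "U \<in> borel_measurable borel" by (rule borel_measurable_mono)
  have "isCont T x" for x using contT by (simp add: continuous_on_eq_continuous_at)
  then obtain \<phi> where "\<And>x. (\<phi> has_vector_derivative T x) (at x)"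
    using einterval_antiderivative[of "-\<infinity>" \<infinity> T] by auto
  then have \<phi>: "(\<phi> has_real_derivative T x) (at x)" for x
    by (simp add: has_real_derivative_iff_has_vector_derivative)
  have "continuous_on UNIV \<phi>"
    using \<phi> by (auto intro!: continuous_at_imp_continuous_on DERIV_isCont)
  then have [measurable]: "\<phi> \<in> borel_measurable borel" by (rule borel_measurable_continuous_onI)

  have int2: "integrable \<mu> (\<lambda>x. x\<^sup>2)"
    using second_moment by (intro integrableI_bounded) auto
  \<comment> \<open>\<open>T\<close> grows linearly and \<open>\<phi>\<close> quadratically, so all terms are \<open>\<mu>\<close>-integrable\<close>
  have growth_integrable: "integrable \<mu> h"
    if [measurable]: "h \<in> borel_measurable borel" and h: "\<And>x. \<bar>h x\<bar> \<le> K * (1 + x\<^sup>2)" for h :: "real \<Rightarrow> real" and K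
  proof (rule Bochner_Integration.integrable_bound)
    show "integrable \<mu> (\<lambda>x. K * (1 + x\<^sup>2))" using int2 by simp
    show "AE x in \<mu>. norm (h x) \<le> norm (K * (1 + x\<^sup>2))"
      using h by (auto intro: order_trans[OF _ abs_ge_self])
  qed measurable

  define c where "c = \<bar>T 0\<bar> + L"
  have L: "0 \<le> L" using T(3) by (simp add: lipschitz_on_def)
  then have c: "0 \<le> c" by (simp add: c_def)
  have Tc: "\<bar>T x\<bar> \<le> c * (1 + \<bar>x\<bar>)" for x
  proof -
    have "\<bar>T x - T 0\<bar> \<le> L * \<bar>x\<bar>" using lipschitz_onD[OF T(3), of x 0] by (simp add: dist_real_def)
    then have "\<bar>T x\<bar> \<le> \<bar>T 0\<bar> + L * \<bar>x\<bar>" by linarith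
    also have "\<dots> \<le> c * (1 + \<bar>x\<bar>)" using L by (simp add: c_def algebra_simps)
    finally show ?thesis .
  qed
  have abs_sq: "\<bar>x\<bar> * (1 + \<bar>x\<bar>) \<le> 2 * (1 + x\<^sup>2)" "(1 + \<bar>x\<bar>)\<^sup>2 \<le> 2 * (1 + x\<^sup>2)" for x :: real
  proof -
    have "0 \<le> (1 - \<bar>x\<bar>)\<^sup>2" by simp
    then have "2 * \<bar>x\<bar> \<le> 1 + x\<^sup>2" by (simp add: power2_diff)
    then show "(1 + \<bar>x\<bar>)\<^sup>2 \<le> 2 * (1 + x\<^sup>2)" by (simp add: power2_sum)
    have "\<bar>x\<bar> * \<bar>x\<bar> = x\<^sup>2" by (simp add: power2_eq_square)
    then show "\<bar>x\<bar> * (1 + \<bar>x\<bar>) \<le> 2 * (1 + x\<^sup>2)" using \<open>2 * \<bar>x\<bar> \<le> 1 + x\<^sup>2\<close>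
      unfolding distrib_left using zero_le_power2[of x] by linarith
  qed
  have intT2: "integrable \<mu> (\<lambda>x. (T x)\<^sup>2)"
  proof (rule growth_integrable)
    fix x
    have "\<bar>(T x)\<^sup>2\<bar> = \<bar>T x\<bar>\<^sup>2" by simp
    also have "\<dots> \<le> (c * (1 + \<bar>x\<bar>))\<^sup>2" using Tc[of x] by (rule power_mono) simp
    also have "\<dots> = c\<^sup>2 * (1 + \<bar>x\<bar>)\<^sup>2" by (rule power_mult_distrib)
    also have "\<dots> \<le> c\<^sup>2 * (2 * (1 + x\<^sup>2))" by (intro mult_left_mono abs_sq) auto
    finally show "\<bar>(T x)\<^sup>2\<bar> \<le> (c\<^sup>2 * 2) * (1 + x\<^sup>2)" by (simp add: mult.assoc)
  qed measurable
  have intxT: "integrable \<mu> (\<lambda>x. x * T x)"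
  proof (rule growth_integrable)
    fix x
    have "\<bar>x * T x\<bar> \<le> \<bar>x\<bar> * (c * (1 + \<bar>x\<bar>))"
      unfolding abs_mult by (intro mult_left_mono Tc) auto
    also have "\<dots> = c * (\<bar>x\<bar> * (1 + \<bar>x\<bar>))" by simp
    also have "\<dots> \<le> c * (2 * (1 + x\<^sup>2))" using c by (intro mult_left_mono abs_sq) auto
    finally show "\<bar>x * T x\<bar> \<le> (c * 2) * (1 + x\<^sup>2)" by (simp add: mult.assoc)
  qed measurable
  have int\<phi>: "integrable \<mu> \<phi>"
  proof (rule growth_integrable)
    fix x
    have "\<bar>\<phi> x - \<phi> 0\<bar> \<le> \<bar>x\<bar> * (c * (1 + \<bar>x\<bar>))"
    proof (cases "x = 0")
      case False
      have "\<exists>\<xi>. \<bar>\<xi>\<bar> \<le> \<bar>x\<bar> \<and> \<phi> x - \<phi> 0 = x * T \<xi>"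
      proof (cases "0 < x")
        case True
        then show ?thesis using MVT2[of 0 x \<phi> T] \<phi> by force
      next
        case False
        then have "x < 0" using \<open>x \<noteq> 0\<close> by simp
        then obtain \<xi> where "x < \<xi>" "\<xi> < 0" "\<phi> 0 - \<phi> x = (0 - x) * T \<xi>"
          using MVT2[of x 0 \<phi> T] \<phi> by blast
        then show ?thesis by (intro exI[of _ \<xi>]) auto
      qed
      then obtain \<xi> where \<xi>: "\<bar>\<xi>\<bar> \<le> \<bar>x\<bar>" "\<phi> x - \<phi> 0 = x * T \<xi>" by blast
      have "\<bar>T \<xi>\<bar> \<le> c * (1 + \<bar>x\<bar>)"
        using Tc[of \<xi>] \<xi>(1) c by (meson add_left_mono mult_left_mono order_trans)
      then show ?thesis unfolding \<xi>(2) abs_mult by (rule mult_left_mono) simp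
    qed simp
    also have "\<dots> = c * (\<bar>x\<bar> * (1 + \<bar>x\<bar>))" by simp
    also have "\<dots> \<le> c * (2 * (1 + x\<^sup>2))" using c by (intro mult_left_mono abs_sq) auto
    finally have "\<bar>\<phi> x\<bar> \<le> \<bar>\<phi> 0\<bar> + c * (2 * (1 + x\<^sup>2))" by linarith
    also have "\<dots> \<le> (\<bar>\<phi> 0\<bar> + c * 2) * (1 + x\<^sup>2)" by (simp add: algebra_simps)
    finally show "\<bar>\<phi> x\<bar> \<le> (\<bar>\<phi> 0\<bar> + c * 2) * (1 + x\<^sup>2)" .
  qed measurable

  define a where "a = (\<lambda>x. x\<^sup>2 - 2 * \<phi> x)"
  define b where "b = (\<lambda>z. (T z)\<^sup>2 + 2 * \<phi> z - 2 * (z * T z))"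
  define D where "D = (\<lambda>x z. \<phi> x - \<phi> z - T z * (x - z))"
  have [measurable]: "a \<in> borel_measurable borel" "b \<in> borel_measurable borel"
    unfolding a_def b_def by measurable
  have inta: "integrable \<mu> a" and intb: "integrable \<mu> b"
    unfolding a_def b_def using int2 int\<phi> intT2 intxT by auto
  have split: "(x - T z)\<^sup>2 = a x + b z + 2 * D x z" for x z
    by (simp add: a_def b_def D_def power2_eq_square algebra_simps)
  have D_pos: "0 < D x z" if "x \<noteq> z" for x z
    using increasing_antiderivative_above_tangents[OF T(1) \<phi> that] by (simp add: D_def)
  have D_diag: "D x x = 0" for x by (simp add: D_def)
  have D_nonneg: "0 \<le> D x z" for x z using D_pos[of x z] D_diag[of x] by (cases "x = z") auto
  define J where "J = (\<integral>x. a x \<partial>\<mu>) + (\<integral>x. b x \<partial>\<mu>)"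

  have other: "transport_cost \<mu> S = ennreal (J + 2 * (\<integral>x. D x (U (S x)) \<partial>\<mu>)) \<and>
       integrable \<mu> (\<lambda>x. D x (U (S x))) \<and> 0 \<le> J + 2 * (\<integral>x. D x (U (S x)) \<partial>\<mu>)"
    if S: "is_transport_map \<mu> \<nu> S" for S
  proof -
    have [measurable]: "S \<in> borel_measurable borel" and pushS: "distr \<mu> borel S = \<nu>"
      using S by (auto simp: is_transport_map_def)
    have "distr \<mu> borel (\<lambda>x. U (S x)) = distr (distr \<mu> borel S) borel U"
      by (subst distr_distr) (auto simp: comp_def)
    also have "\<dots> = distr (distr \<mu> borel T) borel U" by (simp add: pushS push)
    also have "\<dots> = distr \<mu> borel (\<lambda>x. x)"
      by (subst distr_distr) (auto simp: comp_def UT)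
    also have "\<dots> = \<mu>" by (rule distr_id2) (simp add: sets)
    finally have R: "distr \<mu> borel (\<lambda>x. U (S x)) = \<mu>" .
    have transfer: "integrable \<mu> (\<lambda>x. h (U (S x)))" "(\<integral>x. h (U (S x)) \<partial>\<mu>) = (\<integral>x. h x \<partial>\<mu>)"
      if [measurable]: "h \<in> borel_measurable borel" and "integrable \<mu> h" for h :: "real \<Rightarrow> real"
    proof -
      show "integrable \<mu> (\<lambda>x. h (U (S x)))"
        using that(2) by (subst (asm) R[symmetric]) (simp add: integrable_distr_eq)
      show "(\<integral>x. h (U (S x)) \<partial>\<mu>) = (\<integral>x. h x \<partial>\<mu>)"
        by (subst (2) R[symmetric]) (simp add: integral_distr)
    qed
    have intS2: "integrable \<mu> (\<lambda>x. (S x)\<^sup>2)"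
      using transfer(1)[OF _ intT2] by (simp add: TU)
    have intcost: "integrable \<mu> (\<lambda>x. (x - S x)\<^sup>2)"
    proof (rule Bochner_Integration.integrable_bound)
      show "integrable \<mu> (\<lambda>x. 2 * x\<^sup>2 + 2 * (S x)\<^sup>2)" using int2 intS2 by simp
      have "(x - y)\<^sup>2 \<le> 2 * x\<^sup>2 + 2 * y\<^sup>2" for x y :: real
        using zero_le_power2[of "x + y"] by (simp add: power2_diff power2_sum)
      then show "AE x in \<mu>. norm ((x - S x)\<^sup>2) \<le> norm (2 * x\<^sup>2 + 2 * (S x)\<^sup>2)" by simp
    qed measurable
    have cost: "(x - S x)\<^sup>2 = a x + b (U (S x)) + 2 * D x (U (S x))" for x
      using split[of x "U (S x)"] by (simp add: TU)
    have intbR: "integrable \<mu> (\<lambda>x. b (U (S x)))" and "(\<integral>x. b (U (S x)) \<partial>\<mu>) = (\<integral>x. b x \<partial>\<mu>)"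
      using transfer[OF _ intb] by auto
    have D_eq: "(\<lambda>x. D x (U (S x))) = (\<lambda>x. ((x - S x)\<^sup>2 - a x - b (U (S x))) / 2)"
      by (simp add: cost)
    have intD: "integrable \<mu> (\<lambda>x. D x (U (S x)))"
      unfolding D_eq using intcost inta intbR by auto
    have "(\<integral>x. (x - S x)\<^sup>2 \<partial>\<mu>) = J + 2 * (\<integral>x. D x (U (S x)) \<partial>\<mu>)"
      unfolding cost using inta intbR intD \<open>(\<integral>x. b (U (S x)) \<partial>\<mu>) = (\<integral>x. b x \<partial>\<mu>)\<close>
      by (simp add: J_def)
    moreover have "transport_cost \<mu> S = ennreal (\<integral>x. (x - S x)\<^sup>2 \<partial>\<mu>)"
      unfolding transport_cost_def using intcost by (subst nn_integral_eq_integral[symmetric]) auto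
    moreover have "0 \<le> (\<integral>x. (x - S x)\<^sup>2 \<partial>\<mu>)" by simp
    ultimately show ?thesis using intD by simp
  qed
  have T_map: "is_transport_map \<mu> \<nu> T" using push by (simp add: is_transport_map_def)
  have T_cost: "transport_cost \<mu> T = ennreal J"
    using other[OF T_map] by (simp add: UT D_diag)
  have minimal: "is_minimizing_transport \<mu> \<nu> T"
    unfolding is_minimizing_transport_def
  proof (intro conjI allI impI T_map)
    fix S assume S: "is_transport_map \<mu> \<nu> S"
    have "0 \<le> (\<integral>x. D x (U (S x)) \<partial>\<mu>)" using D_nonneg by (intro integral_nonneg_AE) auto
    then show "transport_cost \<mu> T \<le> transport_cost \<mu> S"
      using other[OF S] T_cost by (simp add: ennreal_leI)
  qed
  show ?thesis
    unfolding is_optimal_transport_def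
  proof (intro conjI allI impI minimal)
    fix S assume "is_minimizing_transport \<mu> \<nu> S"
    then have S: "is_transport_map \<mu> \<nu> S" and "transport_cost \<mu> S \<le> transport_cost \<mu> T"
      using T_map by (auto simp: is_minimizing_transport_def)
    moreover have "0 \<le> J" using other[OF T_map] by (simp add: UT D_diag)
    ultimately have "J + 2 * (\<integral>x. D x (U (S x)) \<partial>\<mu>) \<le> J"
      using other[OF S] T_cost by simp
    moreover have "0 \<le> (\<integral>x. D x (U (S x)) \<partial>\<mu>)" using D_nonneg by (intro integral_nonneg_AE) auto
    ultimately have "(\<integral>x. D x (U (S x)) \<partial>\<mu>) = 0" by simp
    then have "AE x in \<mu>. D x (U (S x)) = 0"
      using other[OF S] D_nonneg by (subst (asm) integral_nonneg_eq_0_iff_AE) auto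
    then show "AE x in \<mu>. S x = T x"
    proof eventually_elim
      fix x assume "D x (U (S x)) = 0"
      then have "x = U (S x)" using D_pos[of x "U (S x)"] by force
      then show "S x = T x" by (metis TU)
    qed
  qed
qed

section \<open>Distribution functions\<close>

lemma cdf_density_strict_mono:
  assumes [measurable]: "h \<in> borel_measurable borel"
    and dist: "real_distribution (density lborel (\<lambda>x. ennreal (h x)))"
    and xy: "x < y" and pos: "\<And>z. x < z \<Longrightarrow> z \<le> y \<Longrightarrow> 0 < h z"
  shows "cdf (density lborel (\<lambda>x. ennreal (h x))) x < cdf (density lborel (\<lambda>x. ennreal (h x))) y"
proof -
  interpret real_distribution "density lborel (\<lambda>x. ennreal (h x))" by (rule dist)
  let ?M = "density lborel (\<lambda>x. ennreal (h x))"
  have "emeasure ?M {x<..y} \<noteq> 0"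
  proof
    assume "emeasure ?M {x<..y} = 0"
    then have "{x<..y} \<in> null_sets ?M" by (simp add: null_sets_def)
    then have "AE z in lborel. z \<in> {x<..y} \<longrightarrow> ennreal (h z) = 0"
      by (simp add: null_sets_density_iff)
    then have "AE z in lborel. z \<notin> {x<..y}"
    proof eventually_elim
      fix z assume "z \<in> {x<..y} \<longrightarrow> ennreal (h z) = 0"
      then show "z \<notin> {x<..y}" using pos[of z] by (auto simp: ennreal_eq_0_iff)
    qed
    then have "{x<..y} \<in> null_sets lborel" by (simp add: AE_iff_null_sets)
    then have "emeasure lborel {x<..y} = 0" by (rule null_setsD1)
    then show False using xy by simp
  qed
  then have "0 < measure ?M {x<..y}" by (simp add: emeasure_eq_measure zero_less_measure_iff)
  then show ?thesis using cdf_diff_eq[OF xy] by simp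
qed

lemma (in real_distribution) cdf_surj:
  assumes cont: "\<And>x. isCont (cdf M) x" and t: "0 < t" "t < 1"
  shows "\<exists>x. cdf M x = t"
proof -
  obtain a where a: "cdf M a < t"
    using order_tendstoD(2)[OF cdf_lim_at_bot t(1)] by (auto simp: eventually_at_bot_linorder)
  obtain b where b: "t < cdf M b"
    using order_tendstoD(1)[OF cdf_lim_at_top_prob t(2)] by (auto simp: eventually_at_top_linorder)
  have "a \<le> b" using a b cdf_nondecreasing[of b a] by linarith
  then show ?thesis using IVT[of "cdf M" a t b] a b cont by auto
qed

section \<open>Transport to a bounded perturbation of a log-concave density\<close>

text \<open>In the application \<open>f = exp (- V)\<close> and \<open>r = exp (- q)\<close>, after \<open>q\<close> has been changed on a null set
  so that its essential bounds \<open>- B \<le> q \<le> A\<close> hold everywhere.\<close>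

locale log_concave_perturbation =
  fixes f r :: "real \<Rightarrow> real" and A B :: real
  assumes f: "log_concave f"
    and A_nonneg: "0 \<le> A" and B_nonneg: "0 \<le> B"
    and r_measurable [measurable]: "r \<in> borel_measurable borel"
    and r_lower: "\<And>x. exp (- A) \<le> r x" and r_upper: "\<And>x. r x \<le> exp B"
    and prob_f: "prob_space (density lborel (\<lambda>x. ennreal (f x)))"
    and prob_g: "prob_space (density lborel (\<lambda>x. ennreal (f x * r x)))"
begin

definition "g x = f x * r x"
definition "\<mu> = density lborel (\<lambda>x. ennreal (f x))"
definition "\<nu> = density lborel (\<lambda>x. ennreal (g x))"

lemma f_measurable [measurable]: "f \<in> borel_measurable borel"
  by (rule log_concave_measurable[OF f])

lemma g_measurable [measurable]: "g \<in> borel_measurable borel"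
  unfolding g_def by measurable

lemma f_nonneg: "0 \<le> f x"
  by (rule log_concave_nonneg[OF f])

lemma r_pos: "0 < r x"
  using r_lower[of x] by (smt (verit) exp_gt_zero)

sublocale mu: real_distribution \<mu>
  using prob_f by (simp add: \<mu>_def real_distribution_def real_distribution_axioms_def)

sublocale nu: real_distribution \<nu>
  using prob_g by (simp add: \<nu>_def g_def real_distribution_def real_distribution_axioms_def)

abbreviation "F \<equiv> cdf \<mu>"
abbreviation "G \<equiv> cdf \<nu>"

lemma nu_le_mu:
  assumes [measurable]: "S \<in> sets borel"
  shows "measure \<nu> S \<le> exp B * measure \<mu> S"
proof -
  have "emeasure \<nu> S \<le> (\<integral>\<^sup>+x. ennreal (exp B) * (ennreal (f x) * indicator S x) \<partial>lborel)"
    unfolding \<nu>_def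
    by (subst emeasure_density)
       (auto simp: g_def indicator_def ennreal_mult'[symmetric] mult.commute[of "exp B"]
             intro!: nn_integral_mono ennreal_leI mult_left_mono r_upper f_nonneg)
  also have "\<dots> = ennreal (exp B) * emeasure \<mu> S"
    unfolding \<mu>_def by (simp add: nn_integral_cmult emeasure_density)
  finally show ?thesis
    by (simp add: mu.emeasure_eq_measure nu.emeasure_eq_measure ennreal_mult'[symmetric])
qed

lemma mu_le_nu:
  assumes [measurable]: "S \<in> sets borel"
  shows "measure \<mu> S \<le> exp A * measure \<nu> S"
proof -
  have le: "f x \<le> exp A * g x" for x
  proof -
    have "1 \<le> exp A * r x" using r_lower[of x] by (simp add: exp_minus field_simps)
    then have "f x * 1 \<le> f x * (exp A * r x)" using f_nonneg by (rule mult_left_mono)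
    then show ?thesis by (simp add: g_def mult.left_commute)
  qed
  have "emeasure \<mu> S \<le> (\<integral>\<^sup>+x. ennreal (exp A) * (ennreal (g x) * indicator S x) \<partial>lborel)"
    unfolding \<mu>_def using le
    by (subst emeasure_density)
       (auto simp: indicator_def ennreal_mult'[symmetric] intro!: nn_integral_mono ennreal_leI)
  also have "\<dots> = ennreal (exp A) * emeasure \<nu> S"
    unfolding \<nu>_def by (simp add: nn_integral_cmult emeasure_density)
  finally show ?thesis
    by (simp add: mu.emeasure_eq_measure nu.emeasure_eq_measure ennreal_mult'[symmetric])
qed

lemma cdf_comparison:
  "G x \<le> exp B * F x" "F x \<le> exp A * G x"
  "1 - G x \<le> exp B * (1 - F x)" "1 - F x \<le> exp A * (1 - G x)"
proof -
  have compl: "1 - F x = measure \<mu> {x<..}" "1 - G x = measure \<nu> {x<..}"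
    using mu.prob_compl[of "{..x}"] nu.prob_compl[of "{..x}"]
    by (simp_all add: cdf_def2 Compl_atMost[symmetric] Compl_eq_Diff_UNIV)
  show "G x \<le> exp B * F x" "F x \<le> exp A * G x"
    unfolding cdf_def2 by (simp_all add: nu_le_mu mu_le_nu)
  show "1 - G x \<le> exp B * (1 - F x)" "1 - F x \<le> exp A * (1 - G x)"
    unfolding compl by (simp_all add: nu_le_mu mu_le_nu)
qed

lemma no_atoms: "measure \<mu> {x} = 0" "measure \<nu> {x} = 0"
proof -
  have "{x} \<in> null_sets lborel" by (simp add: null_sets_def)
  then have "{x} \<in> null_sets \<mu>" "{x} \<in> null_sets \<nu>"
    using absolutely_continuousI_density[of "\<lambda>x. ennreal (f x)" lborel]
      absolutely_continuousI_density[of "\<lambda>x. ennreal (g x)" lborel]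
    by (auto simp: absolutely_continuous_def \<mu>_def \<nu>_def)
  then show "measure \<mu> {x} = 0" "measure \<nu> {x} = 0"
    by (auto simp: null_sets_def measure_def)
qed

lemma F_ratio: "x \<le> y \<Longrightarrow> f y * F x \<le> f x * F y"
  using log_concave_left_tail_ratio[OF f, of x y]
  by (simp add: \<mu>_def[symmetric] mu.emeasure_eq_measure cdf_def2 ennreal_mult'[symmetric]
      f_nonneg)

lemma F_tail_ratio:
  assumes "x \<le> y" shows "f x * (1 - F y) \<le> f y * (1 - F x)"
proof -
  have tail: "measure \<mu> {a..} = 1 - F a" for a
  proof -
    have "measure \<mu> {a..} = measure \<mu> ({a} \<union> {a<..})"
      by (rule arg_cong[where f="measure \<mu>"]) auto
    also have "\<dots> = measure \<mu> {a} + measure \<mu> {a<..}"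
      by (rule mu.finite_measure_Union) auto
    also have "\<dots> = 1 - F a"
      using mu.prob_compl[of "{..a}"]
      by (simp add: no_atoms cdf_def2 Compl_atMost[symmetric] Compl_eq_Diff_UNIV)
    finally show ?thesis .
  qed
  have "0 \<le> f y * (1 - F x)" using mu.cdf_bounded_prob[of x] f_nonneg[of y] by simp
  then show ?thesis
    using log_concave_right_tail_ratio[OF f assms]
    by (simp add: \<mu>_def[symmetric] mu.emeasure_eq_measure ennreal_mult'[symmetric] f_nonneg tail)
qed

text \<open>Up to end points, the interval where \<open>f\<close> is positive. Defined through \<open>F\<close>, it is visibly
  mapped to itself by the transport.\<close>

definition "I = {x. 0 < F x \<and> F x < 1}"

lemma I_borel [measurable]: "I \<in> sets borel"
proof -
  have [measurable]: "F \<in> borel_measurable borel"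
    by (intro borel_measurable_mono monoI mu.cdf_nondecreasing)
  show ?thesis unfolding I_def by measurable
qed

lemma I_iff_G: "x \<in> I \<longleftrightarrow> 0 < G x \<and> G x < 1"
proof -
  have pos: "0 < F x \<longleftrightarrow> 0 < G x"
    using cdf_comparison(1,2)[of x] mu.cdf_nonneg[of x] nu.cdf_nonneg[of x]
    by (smt (verit) exp_gt_zero mult_eq_0_iff)
  have "0 < 1 - F x \<longleftrightarrow> 0 < 1 - G x"
    using cdf_comparison(3,4)[of x] mu.cdf_bounded_prob[of x] nu.cdf_bounded_prob[of x]
    by (smt (verit) exp_gt_zero mult_eq_0_iff)
  with pos show ?thesis by (simp add: I_def)
qed

lemma outside_I: "x \<notin> I \<Longrightarrow> G x = F x"
proof -
  assume "x \<notin> I"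
  then consider "F x = 0" | "F x = 1"
    using mu.cdf_bounded_prob[of x] mu.cdf_nonneg[of x] by (fastforce simp: I_def)
  then show "G x = F x"
  proof cases
    case 1
    then show ?thesis using cdf_comparison(1)[of x] nu.cdf_nonneg[of x] by simp
  next
    case 2
    then show ?thesis using cdf_comparison(3)[of x] nu.cdf_bounded_prob[of x] by simp
  qed
qed

text \<open>A zero of \<open>f\<close> with mass to its left would be followed by zeros only, leaving no mass to its
  right.\<close>

lemma f_pos: assumes "x \<in> I" shows "0 < f x"
proof (rule ccontr)
  assume "\<not> 0 < f x"
  then have fx: "f x = 0" using f_nonneg[of x] by simp
  have zero: "f y = 0" if "x \<le> y" for y
    using F_ratio[OF that] assms f_nonneg[of y] by (simp add: fx I_def mult_le_0_iff)
  have "emeasure \<mu> {x<..} = (\<integral>\<^sup>+z. ennreal (f z) * indicator {x<..} z \<partial>lborel)"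
    unfolding \<mu>_def by (rule emeasure_density) auto
  also have "\<dots> = (\<integral>\<^sup>+(z::real). 0 \<partial>lborel)"
    by (rule nn_integral_cong) (auto simp: indicator_def zero)
  finally have "measure \<mu> {x<..} = 0" by (simp add: measure_def)
  then have "1 - F x = 0"
    using mu.prob_compl[of "{..x}"]
    by (simp add: cdf_def2 Compl_atMost[symmetric] Compl_eq_Diff_UNIV)
  then show False using assms by (simp add: I_def)
qed

lemma g_pos: "x \<in> I \<Longrightarrow> 0 < g x"
  by (simp add: g_def f_pos r_pos)

lemma cdf_strict_on_I:
  assumes xy: "x < y" and I: "x \<in> I \<or> y \<in> I"
  shows "F x < F y" "G x < G y"
proof -
  have between: "z \<in> I" if "x \<in> I" "y \<in> I" "x < z" "z \<le> y" for z
    using that mu.cdf_nondecreasing[of x z] mu.cdf_nondecreasing[of z y] by (auto simp: I_def)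
  have both: "F x < F y \<and> G x < G y" if "x \<in> I" "y \<in> I"
    unfolding \<mu>_def \<nu>_def
  proof (intro conjI cdf_density_strict_mono xy)
    show "0 < f z" "0 < g z" if "x < z" "z \<le> y" for z
      using between[OF \<open>x \<in> I\<close> \<open>y \<in> I\<close> that] by (simp_all add: f_pos g_pos)
  qed (use mu.real_distribution_axioms nu.real_distribution_axioms in \<open>simp_all add: \<mu>_def \<nu>_def\<close>)
  have "F x \<noteq> F y"
  proof
    assume *: "F x = F y"
    then have "x \<in> I" "y \<in> I" using I by (auto simp: I_def)
    then show False using both * by simp
  qed
  then show "F x < F y" using mu.cdf_nondecreasing[of x y] xy by simp
  have "G x \<noteq> G y"
  proof
    assume *: "G x = G y"
    then have "x \<in> I" "y \<in> I" using I by (auto simp: I_iff_G)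
    then show False using both * by simp
  qed
  then show "G x < G y" using nu.cdf_nondecreasing[of x y] xy by simp
qed

text \<open>The quantile coupling \<open>G\<inverse> o F\<close> on \<open>I\<close>. Outside \<open>I\<close> there is no mass, and
  the identity makes \<open>T\<close> an increasing bijection of the line with slope 1 there.\<close>

definition "T x = (if x \<in> I then SOME y. G y = F x else x)"

lemma G_T: "G (T x) = F x"
proof (cases "x \<in> I")
  case True
  then have "\<exists>y. G y = F x"
    by (intro nu.cdf_surj) (auto simp: I_def nu.isCont_cdf no_atoms)
  then show ?thesis using True by (auto simp: T_def intro: someI_ex)
next
  case False
  then show ?thesis by (simp add: T_def outside_I)
qed

lemma T_in_I: "T x \<in> I \<longleftrightarrow> x \<in> I"
  by (simp only: I_iff_G[of "T x"] G_T) (simp add: I_def)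

lemma T_strict_mono: "strict_mono T"
proof (rule strict_monoI)
  fix x y :: real assume xy: "x < y"
  show "T x < T y"
  proof (cases "x \<in> I \<or> y \<in> I")
    case True
    then have "G (T x) < G (T y)" using cdf_strict_on_I[OF xy] by (simp add: G_T)
    then show ?thesis using nu.cdf_nondecreasing[of "T y" "T x"] by (meson not_less)
  next
    case False
    then show ?thesis using xy by (simp add: T_def)
  qed
qed

lemma T_surj: "surj T"
proof -
  have "\<exists>x. y = T x" for y
  proof (cases "y \<in> I")
    case True
    then obtain x where x: "F x = G y"
      using mu.cdf_surj[of "G y"] by (auto simp: I_iff_G mu.isCont_cdf no_atoms)
    then have "x \<in> I" using True I_iff_G[of y] by (simp add: I_def)
    then have "T x \<in> I" by (simp add: T_in_I)
    have "G (T x) = G y" by (simp add: G_T x)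
    then have "T x = y"
      using cdf_strict_on_I(2)[of "T x" y] cdf_strict_on_I(2)[of y "T x"] True by (metis less_irrefl linorder_less_linear)
    then show ?thesis by blast
  next
    case False
    then show ?thesis by (intro exI[of _ y]) (simp add: T_def)
  qed
  then show ?thesis by (simp add: surj_def)
qed

lemma T_measurable [measurable]: "T \<in> borel_measurable borel"
  by (intro borel_measurable_mono strict_mono_mono T_strict_mono)

lemma pushforward: "distr \<mu> borel T = \<nu>"
proof (rule cdf_unique)
  show "real_distribution (distr \<mu> borel T)" by (rule mu.real_distribution_distr) simp
  show "real_distribution \<nu>" by (rule nu.real_distribution_axioms)
  show "cdf (distr \<mu> borel T) = G"
  proof
    fix y
    obtain x where y: "y = T x" using T_surj by (auto simp: surj_def)
    have "T -` {..y} \<inter> space \<mu> = {..x}"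
      using T_strict_mono by (auto simp: y strict_mono_less_eq)
    then show "cdf (distr \<mu> borel T) y = G y"
      by (simp add: cdf_def2[of "distr \<mu> borel T"] measure_distr) (simp add: y G_T cdf_def2[symmetric])
  qed
qed

text \<open>The heart of the proof, where log-concavity enters. Put \<open>y = T x\<close>, so that \<open>F x = G y\<close>. Both
  \<open>F y / F x\<close> and \<open>(1 - F y) / (1 - F x)\<close> then lie between \<open>exp (- B)\<close> and \<open>exp A\<close>, as they compare
  the masses that \<open>\<mu>\<close> and \<open>\<nu>\<close> give to one half-line. The monotonicity of \<open>f / F\<close> and \<open>f / (1 - F)\<close>
  places \<open>f y / f x\<close> between these two ratios, in an order that depends on the sign of \<open>y - x\<close>.\<close>

lemma f_transport_ratio:
  assumes "x \<in> I"
  shows "f (T x) \<le> exp A * f x" "f x \<le> exp B * f (T x)"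
proof -
  have x: "0 < F x" "0 < 1 - F x" using assms by (auto simp: I_def)
  have y: "0 < F (T x)" "0 < 1 - F (T x)" using assms T_in_I by (auto simp: I_def)
  note cmp = cdf_comparison[of "T x", unfolded G_T]
  show "f (T x) \<le> exp A * f x"
  proof (cases "x \<le> T x")
    case True
    have "f (T x) * F x \<le> f x * F (T x)" by (rule F_ratio[OF True])
    also have "\<dots> \<le> f x * (exp A * F x)" by (intro mult_left_mono cmp f_nonneg)
    finally have "F x * f (T x) \<le> F x * (exp A * f x)" by (simp add: ac_simps)
    then show ?thesis using x by (simp add: mult_le_cancel_left_pos)
  next
    case False
    then have "f (T x) * (1 - F x) \<le> f x * (1 - F (T x))" by (intro F_tail_ratio) simp
    also have "\<dots> \<le> f x * (exp A * (1 - F x))" by (intro mult_left_mono cmp f_nonneg)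
    finally have "(1 - F x) * f (T x) \<le> (1 - F x) * (exp A * f x)" by (simp only: ac_simps)
    then show ?thesis using x by (simp add: mult_le_cancel_left_pos)
  qed
  show "f x \<le> exp B * f (T x)"
  proof (cases "x \<le> T x")
    case True
    have "f x * (1 - F (T x)) \<le> f (T x) * (1 - F x)" by (rule F_tail_ratio[OF True])
    also have "\<dots> \<le> f (T x) * (exp B * (1 - F (T x)))" by (intro mult_left_mono cmp f_nonneg)
    finally have "(1 - F (T x)) * f x \<le> (1 - F (T x)) * (exp B * f (T x))" by (simp only: ac_simps)
    then show ?thesis using y by (simp add: mult_le_cancel_left_pos)
  next
    case False
    then have "f x * F (T x) \<le> f (T x) * F x" by (intro F_ratio) simp
    also have "\<dots> \<le> f (T x) * (exp B * F (T x))" by (intro mult_left_mono cmp f_nonneg)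
    finally have "F (T x) * f x \<le> F (T x) * (exp B * f (T x))" by (simp only: ac_simps)
    then show ?thesis using y by (simp add: mult_le_cancel_left_pos)
  qed
qed

text \<open>On \<open>I\<close> this is the derivative of \<open>T\<close> that formal differentiation of \<open>G o T = F\<close> gives.\<close>

definition "w x = (if x \<in> I then f x / g (T x) else 1)"

lemma w_measurable [measurable]: "w \<in> borel_measurable borel"
  unfolding w_def by measurable

lemma w_bounds: "exp (- (A + B)) \<le> w x" "w x \<le> exp (A + B)"
proof -
  \<comment> \<open>one factor \<open>exp A\<close> or \<open>exp B\<close> comes from \<open>f x / f (T x)\<close>, the other one from \<open>r (T x)\<close>\<close>
  have "exp (- (A + B)) \<le> f x / g (T x) \<and> f x / g (T x) \<le> exp (A + B)" if x: "x \<in> I"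
  proof -
    have g: "0 < g (T x)" using x by (simp add: g_pos T_in_I)
    have fT: "0 \<le> f (T x)" by (rule f_nonneg)
    have "f x \<le> exp B * f (T x)" by (rule f_transport_ratio[OF x])
    also have "\<dots> = exp (A + B) * (f (T x) * exp (- A))" by (simp add: exp_add exp_minus)
    also have "\<dots> \<le> exp (A + B) * g (T x)"
      unfolding g_def by (intro mult_left_mono r_lower fT) simp
    finally have upper: "f x \<le> exp (A + B) * g (T x)" .
    have "exp (- (A + B)) * g (T x) \<le> exp (- (A + B)) * (f (T x) * exp B)"
      unfolding g_def by (intro mult_left_mono r_upper fT) simp
    also have "\<dots> = exp (- A) * f (T x)" by (simp add: exp_diff)
    also have "\<dots> \<le> exp (- A) * (exp A * f x)"
      by (intro mult_left_mono f_transport_ratio[OF x]) simp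
    also have "\<dots> = f x" by (simp add: exp_minus)
    finally show ?thesis using upper g by (simp add: pos_le_divide_eq pos_divide_le_eq)
  qed
  then show "exp (- (A + B)) \<le> w x" "w x \<le> exp (A + B)" using A_nonneg B_nonneg by (auto simp: w_def)
qed

lemma w_nonneg: "0 \<le> w x"
  using g_pos[of "T x"] f_nonneg[of x] by (cases "x \<in> I") (simp_all add: w_def T_in_I)

text \<open>\<open>T\<close> pushes \<open>w dx\<close> forward to Lebesgue measure. On \<open>I\<close> this is the transport of \<open>\<mu>\<close> to \<open>\<nu>\<close>,
  tested against \<open>h / g\<close>. Thus the formula for \<open>T'\<close> is available in integrated form although
  nothing is known yet about the differentiability of \<open>T\<close>, and \<open>g\<close> is merely measurable.\<close>

lemma nn_integral_transport:
  assumes [measurable]: "h \<in> borel_measurable borel"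
  shows "(\<integral>\<^sup>+x. h (T x) * ennreal (w x) \<partial>lborel) = (\<integral>\<^sup>+y. h y \<partial>lborel)"
proof -
  define k where "k = (\<lambda>y. h y * ennreal (1 / g y) * indicator I y)"
  have [measurable]: "k \<in> borel_measurable borel" unfolding k_def by measurable
  have "h (T x) * ennreal (w x) = ennreal (f x) * k (T x) + h x * indicator (- I) x" for x
  proof (cases "x \<in> I")
    case True
    then have "ennreal (w x) = ennreal (f x) * ennreal (1 / g (T x))"
      using g_pos[of "T x"] by (simp add: w_def T_in_I ennreal_mult'[symmetric] f_nonneg)
    then show ?thesis using True by (simp add: k_def T_in_I ac_simps)
  next
    case False
    then show ?thesis by (simp add: k_def T_in_I w_def) (simp add: T_def)
  qed
  then have "(\<integral>\<^sup>+x. h (T x) * ennreal (w x) \<partial>lborel) =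
      (\<integral>\<^sup>+x. ennreal (f x) * k (T x) \<partial>lborel) + (\<integral>\<^sup>+x. h x * indicator (- I) x \<partial>lborel)"
    by (simp add: nn_integral_add)
  also have "(\<integral>\<^sup>+x. ennreal (f x) * k (T x) \<partial>lborel) = (\<integral>\<^sup>+x. k (T x) \<partial>\<mu>)"
    unfolding \<mu>_def by (simp add: nn_integral_density)
  also have "\<dots> = (\<integral>\<^sup>+y. k y \<partial>\<nu>)"
    by (subst pushforward[symmetric]) (simp add: nn_integral_distr)
  also have "\<dots> = (\<integral>\<^sup>+y. ennreal (g y) * k y \<partial>lborel)"
    unfolding \<nu>_def by (simp add: nn_integral_density)
  also have "\<dots> = (\<integral>\<^sup>+y. h y * indicator I y \<partial>lborel)"
  proof (rule nn_integral_cong)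
    fix y
    show "ennreal (g y) * k y = h y * indicator I y"
    proof (cases "y \<in> I")
      case True
      then have "ennreal (g y) * ennreal (1 / g y) = 1"
        using g_pos[of y] by (simp add: ennreal_mult'[symmetric])
      then show ?thesis using True by (simp add: k_def mult.left_commute[of "ennreal (g y)"])
    qed (simp add: k_def)
  qed
  also have "(\<integral>\<^sup>+y. h y * indicator I y \<partial>lborel) + (\<integral>\<^sup>+x. h x * indicator (- I) x \<partial>lborel)
      = (\<integral>\<^sup>+y. h y * indicator I y + h y * indicator (- I) y \<partial>lborel)"
    by (subst nn_integral_add) auto
  also have "\<dots> = (\<integral>\<^sup>+y. h y \<partial>lborel)"
    by (intro nn_integral_cong) (auto simp: indicator_def)
  finally show ?thesis .
qed

lemma T_indefinite_integral:
  assumes "u \<le> v"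
  shows "(w has_integral (T v - T u)) {u..v}"
proof -
  have le: "T u \<le> T v" using assms T_strict_mono by (simp add: strict_mono_less_eq)
  have "ennreal (indicator {u..v} x * w x) = indicator {T u..T v} (T x) * ennreal (w x)" for x
    using T_strict_mono by (auto simp: indicator_def strict_mono_less_eq)
  then have "(\<integral>\<^sup>+x. ennreal (indicator {u..v} x * w x) \<partial>lborel) = ennreal (T v - T u)"
    using le by (simp add: nn_integral_transport)
  then have "((\<lambda>x. indicator {u..v} x * w x) has_integral (T v - T u)) UNIV"
    using le by (intro nn_integral_has_integral) (auto simp: w_nonneg)
  moreover have "(\<lambda>x. indicator {u..v} x * w x) = (\<lambda>x. if x \<in> {u..v} then w x else 0)"
    by (auto simp: indicator_def)
  ultimately show ?thesis by (simp only: has_integral_restrict_UNIV)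
qed

lemma T_lipschitz: "(exp (A + B))-lipschitz_on UNIV T"
proof -
  have "\<bar>T u - T v\<bar> \<le> exp (A + B) * \<bar>u - v\<bar>" if "u \<le> v" for u v
  proof -
    have "T v - T u \<le> exp (A + B) * (v - u)"
    proof (rule has_integral_le)
      show "(w has_integral (T v - T u)) {u..v}" by (rule T_indefinite_integral[OF that])
      show "((\<lambda>x. exp (A + B)) has_integral exp (A + B) * (v - u)) {u..v}"
        using has_integral_const_real[of "exp (A + B)" u v] that by (simp add: mult.commute)
    qed (rule w_bounds)
    moreover have "T u \<le> T v" using that T_strict_mono by (simp add: strict_mono_less_eq)
    ultimately show ?thesis using that by simp
  qed
  then show ?thesis
    by (intro lipschitz_onI) (metis abs_minus_commute dist_real_def linorder_linear, simp)
qed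

lemma second_moment: "(\<integral>\<^sup>+x. ennreal (x\<^sup>2) \<partial>\<mu>) < \<infinity>"
proof -
  have "(\<integral>\<^sup>+x. ennreal (f x) \<partial>lborel) = emeasure \<mu> UNIV"
    unfolding \<mu>_def by (subst emeasure_density) auto
  also have "\<dots> = 1" using mu.emeasure_space_1 by simp
  finally have "(\<integral>\<^sup>+x. ennreal (f x * x\<^sup>2) \<partial>lborel) < \<infinity>"
    by (intro log_concave_second_moment f) simp
  then show ?thesis
    unfolding \<mu>_def by (simp add: nn_integral_density ennreal_mult' f_nonneg)
qed

end

section \<open>Lebesgue measurable densities and essential bounds\<close>

lemma density_measure_eq_density_lborel:
  assumes h: "h \<in> borel_measurable lebesgue" and h': "h' \<in> borel_measurable borel"
    and eq: "AE x in lebesgue. h x = h' x"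
  shows "density_measure h = density lborel (\<lambda>x. ennreal (h' x))"
proof (rule measure_eqI)
  fix E assume "E \<in> sets (density_measure h)"
  then have E [measurable]: "E \<in> sets borel" by (simp add: density_measure_def)
  then have EL: "E \<in> sets lebesgue" by (simp add: sets_completionI_sets)
  have id: "(\<lambda>x. x) \<in> borel_measurable lebesgue"
    by (rule measurable_completion) simp
  then have id': "(\<lambda>x. x) \<in> density lebesgue (\<lambda>x. ennreal (h x)) \<rightarrow>\<^sub>M borel"
    by (simp cong: measurable_cong_sets)
  have "emeasure (density_measure h) E = (\<integral>\<^sup>+x. ennreal (h x) * indicator E x \<partial>lebesgue)"
    using h EL unfolding density_measure_def
    by (simp add: emeasure_distr[OF id' E] emeasure_density)
  also have "\<dots> = (\<integral>\<^sup>+x. ennreal (h' x) * indicator E x \<partial>lebesgue)"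
    using eq by (intro nn_integral_cong_AE) auto
  also have "\<dots> = (\<integral>\<^sup>+x. ennreal (h' x) * indicator E x \<partial>lborel)"
    by (rule nn_integral_completion)
  also have "\<dots> = emeasure (density lborel (\<lambda>x. ennreal (h' x))) E"
    using h' by (simp add: emeasure_density)
  finally show "emeasure (density_measure h) E = emeasure (density lborel (\<lambda>x. ennreal (h' x))) E" .
qed (simp add: density_measure_def)

lemma lebesgue_measurable_AE_eq:
  fixes h k :: "real \<Rightarrow> 'b::topological_space"
  assumes k: "k \<in> borel_measurable lebesgue" and eq: "AE x in lebesgue. h x = k x"
  shows "h \<in> borel_measurable lebesgue"
proof (rule measurableI)
  fix S :: "'b set" assume "S \<in> sets borel"
  then have k_S: "k -` S \<inter> space lebesgue \<in> sets lebesgue" by (rule measurable_sets[OF k])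
  have "AE x in lebesgue. x \<in> k -` S \<inter> space lebesgue \<longleftrightarrow> x \<in> h -` S \<inter> space lebesgue"
    using eq by eventually_elim auto
  then show "h -` S \<inter> space lebesgue \<in> sets lebesgue"
    by (rule completion.in_sets_AE[OF _ k_S]) simp
qed simp

lemma Linf_norm_bounded:
  fixes h :: "real \<Rightarrow> real"
  assumes [measurable]: "h \<in> borel_measurable lebesgue" and K: "\<And>x. \<bar>h x\<bar> \<le> K"
  obtains A where "0 \<le> A" "Linf_norm (\<lambda>x. ereal (h x)) = ereal A" "AE x in lebesgue. \<bar>h x\<bar> \<le> A"
proof -
  let ?N = "Linf_norm (\<lambda>x. ereal (h x))"
  have "0 = esssup (lebesgue :: real measure) (\<lambda>x. 0 :: ereal)"
    by (rule esssup_const[symmetric]) simp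
  also have "\<dots> \<le> ?N" unfolding Linf_norm_def by (rule esssup_mono) auto
  finally have "0 \<le> ?N" .
  moreover have "?N \<le> ereal K"
    unfolding Linf_norm_def using K by (intro esssup_I) auto
  ultimately obtain A where A: "?N = ereal A" "0 \<le> A" by (cases ?N) auto
  have "AE x in lebesgue. \<bar>ereal (h x)\<bar> \<le> ?N" unfolding Linf_norm_def by (rule esssup_AE)
  then have "AE x in lebesgue. \<bar>h x\<bar> \<le> A" by (simp add: A)
  with A show thesis using that by blast
qed

section \<open>The transport estimate\<close>

theorem theorem1p2:
  fixes V :: "real \<Rightarrow> ereal" and q :: "real \<Rightarrow> real"
  assumes "convex_extended V"
    and "q \<in> borel_measurable lebesgue"
    and "bounded (range q)"
    and "prob_space (density_measure (\<lambda>x. exp_neg (V x)))"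
    and "prob_space (density_measure (\<lambda>x. exp_neg (V x + ereal (q x))))"
  shows "\<exists>T :: real \<Rightarrow> real.
      is_optimal_transport (density_measure (\<lambda>x. exp_neg (V x)))
        (density_measure (\<lambda>x. exp_neg (V x + ereal (q x)))) T \<and>
      (\<exists>L. L-lipschitz_on UNIV T) \<and>
      (AE x in lebesgue. T differentiable (at x)) \<and>
      Linf_norm (\<lambda>x. log_ext (deriv T x))
        \<le> Linf_norm (\<lambda>x. ereal (max (q x) 0)) + Linf_norm (\<lambda>x. ereal (max (- q x) 0))"
proof -
  note [measurable] = assms(2)
  define f where "f = (\<lambda>x. exp_neg (V x))"
  have f: "log_concave f" unfolding f_def by (rule log_concave_exp_neg[OF assms(1)])
  have f_borel: "f \<in> borel_measurable borel" by (rule log_concave_measurable[OF f])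
  then have [measurable]: "f \<in> borel_measurable lebesgue" by (intro measurable_completion) simp
  obtain K where K: "\<And>x. \<bar>q x\<bar> \<le> K" using assms(3) by (auto simp: bounded_iff)
  obtain A where A: "0 \<le> A" "Linf_norm (\<lambda>x. ereal (max (q x) 0)) = ereal A"
      "AE x in lebesgue. \<bar>max (q x) 0\<bar> \<le> A"
  proof (rule Linf_norm_bounded[of "\<lambda>x. max (q x) 0" K])
    show "\<bar>max (q x) 0\<bar> \<le> K" for x using K[of x] by (auto simp: max_def)
  qed auto
  obtain B where B: "0 \<le> B" "Linf_norm (\<lambda>x. ereal (max (- q x) 0)) = ereal B"
      "AE x in lebesgue. \<bar>max (- q x) 0\<bar> \<le> B"
  proof (rule Linf_norm_bounded[of "\<lambda>x. max (- q x) 0" K])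
    show "\<bar>max (- q x) 0\<bar> \<le> K" for x using K[of x] by (auto simp: max_def)
  qed auto
  obtain q0 where q0 [measurable]: "q0 \<in> borel_measurable borel" and "AE x in lborel. q x = q0 x"
    using completion_ex_borel_measurable_real[OF assms(2)] by auto
  then have q_q0: "AE x in lebesgue. q x = q0 x" by (intro AE_completion)
  \<comment> \<open>clamping alters \<open>q\<close> only on a null set and makes the essential bounds hold everywhere\<close>
  define r where "r = (\<lambda>x. exp (- max (- B) (min A (q0 x))))"
  have r_borel [measurable]: "r \<in> borel_measurable borel" unfolding r_def by measurable
  have r: "exp (- A) \<le> r x" "r x \<le> exp B" for x using A(1) B(1) by (auto simp: r_def)
  have source: "density_measure (\<lambda>x. exp_neg (V x)) = density lborel (\<lambda>x. ennreal (f x))"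
    unfolding f_def[symmetric] using f_borel by (intro density_measure_eq_density_lborel) auto
  have "exp_neg (V x + ereal (q x)) = f x * exp (- q x)" for x
    using assms(1) by (cases "V x") (auto simp: f_def exp_neg_def convex_extended_def exp_add[symmetric])
  then have target: "density_measure (\<lambda>x. exp_neg (V x + ereal (q x))) = density lborel (\<lambda>x. ennreal (f x * r x))"
  proof (simp only:, intro density_measure_eq_density_lborel)
    show "(\<lambda>x. f x * r x) \<in> borel_measurable borel" using f_borel by measurable
    show "AE x in lebesgue. f x * exp (- q x) = f x * r x"
      using A(3) B(3) q_q0
    proof eventually_elim
      fix x assume bnd: "\<bar>max (q x) 0\<bar> \<le> A" "\<bar>max (- q x) 0\<bar> \<le> B" and eq: "q x = q0 x"
      have "q0 x \<le> A" "- B \<le> q0 x" using bnd unfolding eq by linarith+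
      then have "max (- B) (min A (q0 x)) = q x" by (simp only: eq min.absorb2 max.absorb2)
      then show "f x * exp (- q x) = f x * r x" by (simp only: r_def)
    qed
  qed measurable
  interpret log_concave_perturbation f r A B
    by (intro log_concave_perturbation.intro f A(1) B(1) r r_borel assms(4)[unfolded source] assms(5)[unfolded target])
  have deriv: "AE x in lebesgue. (T has_real_derivative w x) (at x)"
    by (rule AE_has_derivative_indefinite_integral[OF w_measurable w_nonneg w_bounds(2)])
       (rule T_indefinite_integral)
  have w_pos: "0 < w x" for x using w_bounds(1)[of x] by (smt (verit) exp_gt_zero)
  have log_w: "\<bar>ln (w x)\<bar> \<le> A + B" for x
  proof -
    have "ln (exp (- (A + B))) \<le> ln (w x)" "ln (w x) \<le> ln (exp (A + B))"
      using w_bounds[of x] w_pos[of x] by (simp_all del: ln_exp)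
    then show ?thesis by simp
  qed
  have log_deriv: "AE x in lebesgue. log_ext (deriv T x) = ereal (ln (w x))"
    using deriv
  proof eventually_elim
    fix x assume "(T has_real_derivative w x) (at x)"
    then show "log_ext (deriv T x) = ereal (ln (w x))"
      using w_pos[of x] by (simp add: DERIV_imp_deriv log_ext_def not_le)
  qed
  have "(\<lambda>x. ereal (ln (w x))) \<in> borel_measurable lebesgue" by (intro measurable_completion) simp
  then have [measurable]: "(\<lambda>x. log_ext (deriv T x)) \<in> borel_measurable lebesgue"
    using log_deriv by (rule lebesgue_measurable_AE_eq)
  have "Linf_norm (\<lambda>x. log_ext (deriv T x)) \<le> ereal (A + B)"
    unfolding Linf_norm_def
  proof (rule esssup_I)
    show "AE x in lebesgue. \<bar>log_ext (deriv T x)\<bar> \<le> ereal (A + B)"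
      using log_deriv by eventually_elim (use log_w in simp)
  qed measurable
  moreover have "is_optimal_transport \<mu> \<nu> T"
    by (rule increasing_lipschitz_transport_optimal[OF mu.prob_space_axioms _ second_moment
          T_strict_mono T_surj T_lipschitz pushforward]) simp
  moreover have "AE x in lebesgue. T differentiable (at x)"
    using deriv by eventually_elim (auto simp: real_differentiable_def)
  ultimately show ?thesis
    using T_lipschitz unfolding source target A(2) B(2) \<mu>_def \<nu>_def g_def
    by (intro exI[of _ T]) auto
qed

end
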